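(* A solution $v$ of $H(x,Dv)=0$ in $\mathbb{R}^N$ is a weak KAM solution if and only if it is bounded from below.
   Context: $H:\mathbb{R}^N\times\mathbb{R}^N\to\mathbb{R}$ satisfies: (A1) $H$ is continuous; (A2) $p\mapsto H(x,p)$ is convex for every $x$, and for every $R>0$, $\lim_{r\to+\infty}\inf\{H(x,p)\mid |x|<R,\ |p|\ge r\}=+\infty$; (A3) there is $\varepsilon>0$ with $\limsup_{|x|\to+\infty}\sup_{|p|<\varepsilon}H(x,p)<\max_{x\in\mathbb{R}^N}\min_{p\in\mathbb{R}^N}H(x,p)$. Solutions and subsolutions are in the viscosity sense. The critical value $c=\inf\{a\in\mathbb{R}\mid H(x,Du)=a \text{ admits subsolutions in }\mathbb{R}^N\}$ is finite and is normalized to be $c=0$. Set $S_0(x,y)=\sup\{u(y)-u(x)\mid u \text{ subsolution of } H(x,Du)=0\text{ in }\mathbb{R}^N\}$ and $\mathcal{A}=\{y\in\mathbb{R}^N\mid S_0(y,\cdot)\text{ is a solution of }H(x,Du)=0\text{ in }\mathbb{R}^N\}$ (the Aubry set, nonempty and compact). A solution $v$ of $H(x,Dv)=0$ in $\mathbb{R}^N$ is a weak KAM solution if $v(x)=\min\{v(y)+S_0(y,x)\mid y\in\mathcal{A}\}$ for all $x\in\mathbb{R}^N$. *)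

theory Defs
  imports "HOL-Analysis.Analysis"
begin

definition C1_with_gradient ::
    "('a::euclidean_space \<Rightarrow> real) \<Rightarrow> ('a \<Rightarrow> 'a) \<Rightarrow> bool" where
  "C1_with_gradient \<phi> G \<longleftrightarrow>
     (\<forall>x. GDERIV \<phi> x :> G x) \<and> continuous_on UNIV G"

(* Viscosity notions for H(x,Du) = a on the whole space. As usual for coercive
   Hamiltonians, sub- and supersolutions are taken to be continuous. The test
   functions touch at local extrema. *)

definition viscosity_subsolution ::
    "('a::euclidean_space \<Rightarrow> 'a \<Rightarrow> real) \<Rightarrow> real \<Rightarrow> ('a \<Rightarrow> real) \<Rightarrow> bool" where
  "viscosity_subsolution H a u \<longleftrightarrow>
     continuous_on UNIV u \<and>
     (\<forall>\<phi> G x. C1_with_gradient \<phi> G \<longrightarrow>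
        (\<forall>\<^sub>F y in nhds x. u y - \<phi> y \<le> u x - \<phi> x) \<longrightarrow> H x (G x) \<le> a)"

definition viscosity_supersolution ::
    "('a::euclidean_space \<Rightarrow> 'a \<Rightarrow> real) \<Rightarrow> real \<Rightarrow> ('a \<Rightarrow> real) \<Rightarrow> bool" where
  "viscosity_supersolution H a u \<longleftrightarrow>
     continuous_on UNIV u \<and>
     (\<forall>\<phi> G x. C1_with_gradient \<phi> G \<longrightarrow>
        (\<forall>\<^sub>F y in nhds x. u y - \<phi> y \<ge> u x - \<phi> x) \<longrightarrow> H x (G x) \<ge> a)"

definition viscosity_solution ::
    "('a::euclidean_space \<Rightarrow> 'a \<Rightarrow> real) \<Rightarrow> real \<Rightarrow> ('a \<Rightarrow> real) \<Rightarrow> bool" where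
  "viscosity_solution H a u \<longleftrightarrow>
     viscosity_subsolution H a u \<and> viscosity_supersolution H a u"

(* Extended-real valued, so that the equation "critical_value H = 0" also says that
   the set of admissible levels is nonempty and bounded below. *)
definition critical_value :: "('a::euclidean_space \<Rightarrow> 'a \<Rightarrow> real) \<Rightarrow> ereal" where
  "critical_value H = (INF a\<in>{a. \<exists>u. viscosity_subsolution H a u}. ereal a)"

(* The supremum is taken in the reals. For a continuous coercive Hamiltonian with
   critical value 0 the set is nonempty (critical subsolutions exist) and bounded
   above (subsolutions are locally equi-Lipschitz), so it is the true supremum. *)
definition S0 :: "('a::euclidean_space \<Rightarrow> 'a \<Rightarrow> real) \<Rightarrow> 'a \<Rightarrow> 'a \<Rightarrow> real" where
  "S0 H x y = Sup {u y - u x | u. viscosity_subsolution H 0 u}"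

definition aubry_set :: "('a::euclidean_space \<Rightarrow> 'a \<Rightarrow> real) \<Rightarrow> 'a set" where
  "aubry_set H = {y. viscosity_solution H 0 (S0 H y)}"

(* The two conjuncts under the quantifier say that v x is the minimum (attained) of
   v y + S0 H y x over the Aubry set. *)
definition weak_KAM_solution ::
    "('a::euclidean_space \<Rightarrow> 'a \<Rightarrow> real) \<Rightarrow> ('a \<Rightarrow> real) \<Rightarrow> bool" where
  "weak_KAM_solution H v \<longleftrightarrow>
     viscosity_solution H 0 v \<and>
     (\<forall>x. (\<exists>y\<in>aubry_set H. v x = v y + S0 H y x) \<and>
          (\<forall>y\<in>aubry_set H. v x \<le> v y + S0 H y x))"

(* For every x the point q x minimizes H x, and x0 maximizes the resulting minimum,
   so H x0 (q x0) is max_x min_p H(x,p). *)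
definition uniformly_below_max_min_at_infinity ::
    "('a::euclidean_space \<Rightarrow> 'a \<Rightarrow> real) \<Rightarrow> bool" where
  "uniformly_below_max_min_at_infinity H \<longleftrightarrow>
     (\<exists>q x0. (\<forall>x p. H x (q x) \<le> H x p) \<and>
             (\<forall>x. H x (q x) \<le> H x0 (q x0)) \<and>
             (\<exists>\<epsilon>>0. Limsup at_infinity (\<lambda>x. SUP p\<in>{p. norm p < \<epsilon>}. ereal (H x p))
                      < ereal (H x0 (q x0))))"

end

theory Submission
  imports Defs
begin

text \<open>
  Everything rests on a description of subsolutions that does not mention test functions. Freeze the
  Hamiltonian at a point \<open>x\<close>: a function \<open>u\<close> is a subsolution of \<open>H(x, Du) = a\<close> if and only if,
  for every \<open>x\<close> and \<open>\<eta> > 0\<close>, the increments \<open>u z - u y\<close> between points \<open>y, z\<close> close to \<open>x\<close> are at most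
  the support function of the convex compact set \<open>{p. H x p \<le> a + \<eta>}\<close> in the direction \<open>z - y\<close>
  (\<open>frozen_subsolution_if_subsolution\<close>, \<open>subsolution_if_frozen_subsolution\<close>). In this form it is
  evident that minima, maxima, suprema and convex combinations of subsolutions are subsolutions, and
  that a subsolution can be strict at a single point, namely when the condition holds there with a
  negative level. A supersolution of level \<open>0\<close> cannot be touched from below by a function that is
  strict at the point of contact (\<open>supersolution_not_touched_by_strict_subsolution\<close>, by doubling the
  variables). Hence \<open>y\<close> lies in the Aubry set if and only if no critical subsolution is strict at \<open>y\<close>:
  if \<open>S\<^sub>0(y, \<cdot>)\<close> fails to be a supersolution, it can be pushed up near the point of failure, which by
  maximality of \<open>S\<^sub>0(y, \<cdot>)\<close> can only be \<open>y\<close> itself, and the result is strict there.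

  A critical subsolution forces \<open>min\<^sub>p H(x, p) \<le> 0\<close> for all \<open>x\<close>, so the condition at infinity makes
  \<open>H(x, p)\<close> uniformly negative for large \<open>x\<close> and small \<open>p\<close>. Functions of small slope are therefore
  strict subsolutions outside a ball, and a critical subsolution \<open>u\<close> can be replaced far away by such
  a function, from above or from below (\<open>subsolution_glue\<close>).

  Suppose \<open>v\<close> is a weak KAM solution. Continuing \<open>v\<close> by a growing cone shows that the Aubry set
  is bounded, and continuing it by a constant gives a critical subsolution \<open>u\<close> that is bounded below.
  As \<open>v x = v y + S\<^sub>0(y, x) \<ge> v y + u x - u y\<close> for some \<open>y\<close> in a bounded set, \<open>v\<close> is bounded below.

  Suppose conversely that \<open>v\<close> is bounded below, and that at some \<open>x\<^sub>0\<close> no point \<open>y\<close> of the Aubry set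
  gives \<open>v x\<^sub>0 = v y + S\<^sub>0(y, x\<^sub>0)\<close>. Then every Aubry point \<open>y\<close> has a critical subsolution that agrees
  with \<open>v\<close> at \<open>x\<^sub>0\<close> and is below \<open>v\<close> near \<open>y\<close>, while every other point has one that is strict near it.
  By compactness, minima of the former and averages of the latter combine to two critical
  subsolutions \<open>w\<close> and \<open>u\<close>, both equal to \<open>v\<close> at \<open>x\<^sub>0\<close>, such that at every point of a large ball \<open>w < v\<close>
  or \<open>u\<close> is strict. Since \<open>v\<close> is bounded below, cutting \<open>w\<close> with a decreasing cone gives \<open>w < v\<close> on the
  boundary of the ball. For small \<open>l > 0\<close> the function \<open>v - ((1 - l) w + l u)\<close>
  then attains its minimum over the ball at an interior point where \<open>u\<close> is strict, which the
  comparison above excludes.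
\<close>

section \<open>Test functions and elementary estimates\<close>

lemma C1_with_gradient_sum_of_squares:
  fixes a b :: "'a::euclidean_space"
  shows "C1_with_gradient (\<lambda>z. c * (norm (z - a))\<^sup>2 + d * (norm (z - b))\<^sup>2)
           (\<lambda>z. (2 * c) *\<^sub>R (z - a) + (2 * d) *\<^sub>R (z - b))"
proof -
  have "GDERIV (\<lambda>z. c * (norm (z - a))\<^sup>2 + d * (norm (z - b))\<^sup>2) x
          :> (2 * c) *\<^sub>R (x - a) + (2 * d) *\<^sub>R (x - b)" for x
    unfolding gderiv_def power2_norm_eq_inner
    by (auto intro!: derivative_eq_intros
        simp: inner_add_right inner_commute algebra_simps)
  then show ?thesis
    unfolding C1_with_gradient_def by (auto intro!: continuous_intros)
qed

lemma C1_with_gradient_diff: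
  assumes "C1_with_gradient f F" "C1_with_gradient g G"
  shows "C1_with_gradient (\<lambda>z. f z - g z) (\<lambda>z. F z - G z)"
  using assms unfolding C1_with_gradient_def
  by (auto intro: GDERIV_diff continuous_intros)

lemma C1_with_gradient_continuous_on:
  assumes "C1_with_gradient f F"
  shows "continuous_on UNIV f"
  using assms unfolding C1_with_gradient_def gderiv_def
  by (meson continuous_at_imp_continuous_on has_derivative_continuous)

text \<open>Cutting \<open>[0, 1]\<close> into \<open>N\<close> equal steps, the errors add up to \<open>C / N\<close>, which vanishes as
  \<open>N\<close> grows.\<close>

lemma increment_le_of_quadratic_steps:
  fixes g :: "real \<Rightarrow> real"
  assumes step: "\<And>t h. 0 \<le> t \<Longrightarrow> 0 \<le> h \<Longrightarrow> t + h \<le> 1 \<Longrightarrow> g (t + h) - g t \<le> h * s + C * h\<^sup>2"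
  shows "g 1 - g 0 \<le> s"
proof -
  have bound: "g 1 - g 0 \<le> s + C / real N" if N: "N > 0" for N :: nat
  proof -
    define A where "A = s / real N + C / (real N)\<^sup>2"
    have "k \<le> N \<Longrightarrow> g (real k / real N) - g 0 \<le> real k * A" for k
    proof (induction k)
      case (Suc k)
      have eq: "real k / real N + 1 / real N = real (Suc k) / real N"
        by (simp add: add_divide_distrib)
      have "real k / real N + 1 / real N \<le> 1"
        unfolding eq using Suc.prems N by simp
      from step[OF _ _ this]
      have "g (real (Suc k) / real N) - g (real k / real N) \<le> A"
        unfolding eq A_def by (simp add: power_divide)
      moreover have "real (Suc k) * A = real k * A + A" by (simp add: algebra_simps)
      moreover have "g (real k / real N) - g 0 \<le> real k * A" using Suc by simp
      ultimately show ?case by linarith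
    qed simp
    from this[of N] have "g (real N / real N) - g 0 \<le> real N * A" by simp
    moreover have "real N * A = s + C / real N"
      using N by (simp add: A_def distrib_left power2_eq_square)
    ultimately show ?thesis using N by simp
  qed
  have "(\<lambda>N. s + C / real N) \<longlonglongrightarrow> s + 0"
    by (intro tendsto_intros lim_const_over_n)
  then show ?thesis
    using bound by (intro LIMSEQ_le_const[of _ s]) (auto intro!: exI[of _ 1])
qed

lemma lipschitz_on_cone:
  fixes c k :: real
  shows "\<bar>k\<bar>-lipschitz_on UNIV (\<lambda>x :: 'a::real_normed_vector. c + k * norm x)"
proof (rule lipschitz_onI)
  fix x y :: 'a
  have "\<bar>k\<bar> * \<bar>norm x - norm y\<bar> \<le> \<bar>k\<bar> * norm (x - y)"
    by (intro mult_left_mono norm_triangle_ineq3) simp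
  then show "dist (c + k * norm x) (c + k * norm y) \<le> \<bar>k\<bar> * dist x y"
    by (simp add: dist_real_def dist_norm abs_mult[symmetric] right_diff_distrib)
qed simp

section \<open>Convex coercive Hamiltonians and their sublevel sets\<close>

locale coercive_hamiltonian =
  fixes H :: "'a::euclidean_space \<Rightarrow> 'a \<Rightarrow> real"
  assumes H_continuous: "continuous_on UNIV (\<lambda>(x, p). H x p)"
    and H_convex: "\<And>x. convex_on UNIV (H x)"
    and H_coercive: "\<And>R a. \<exists>K. \<forall>x p. norm x < R \<longrightarrow> H x p \<le> a \<longrightarrow> norm p \<le> K"
begin

text \<open>Sublevel sets over a neighbourhood of \<open>x\<close> lie in one compact set, where \<open>H\<close> is uniformly
  continuous.\<close>

lemma sublevel_perturbation:
  assumes "\<eta> > 0"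
  obtains \<rho> where "\<rho> > 0"
    "\<And>x1 x2 p1 p2. dist x x1 < \<rho> \<Longrightarrow> dist x x2 < \<rho> \<Longrightarrow> dist p1 p2 < \<rho> \<Longrightarrow> H x1 p1 \<le> a \<Longrightarrow> H x2 p2 \<le> a + \<eta>"
proof -
  obtain K where K: "\<And>y p. norm y < norm x + 1 \<Longrightarrow> H y p \<le> a \<Longrightarrow> norm p \<le> K"
    using H_coercive by blast
  let ?C = "cball x 1 \<times> cball 0 (K + 1)"
  have "uniformly_continuous_on ?C (\<lambda>(x, p). H x p)"
    by (intro compact_uniformly_continuous compact_Times compact_cball
        continuous_on_subset[OF H_continuous]) auto
  then obtain d where d: "d > 0"
    "\<And>c c'. c \<in> ?C \<Longrightarrow> c' \<in> ?C \<Longrightarrow> dist c' c < d \<Longrightarrow>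
      dist ((\<lambda>(x, p). H x p) c') ((\<lambda>(x, p). H x p) c) < \<eta>"
    unfolding uniformly_continuous_on_def using assms by metis
  define \<rho> where "\<rho> = min 1 (d / 4)"
  show thesis
  proof
    show "\<rho> > 0" using d(1) by (simp add: \<rho>_def)
    fix x1 x2 p1 p2
    assume *: "dist x x1 < \<rho>" "dist x x2 < \<rho>" "dist p1 p2 < \<rho>" "H x1 p1 \<le> a"
    have "norm x1 < norm x + 1"
      using *(1) norm_triangle_ineq2[of x1 x] by (simp add: \<rho>_def dist_norm norm_minus_commute)
    then have "norm p1 \<le> K" using K *(4) by blast
    moreover have "norm p2 \<le> norm p1 + 1"
      using *(3) norm_triangle_ineq2[of p2 p1] by (simp add: \<rho>_def dist_norm norm_minus_commute)
    ultimately have "(x1, p1) \<in> ?C" "(x2, p2) \<in> ?C" using * by (auto simp: \<rho>_def)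
    moreover have "dist (x2, p2) (x1, p1) < d"
    proof -
      have "dist (x2, p2) (x1, p1) \<le> dist x2 x1 + dist p2 p1"
        by (simp add: dist_Pair_Pair sqrt_sum_squares_le_sum)
      also have "dist x2 x1 < 2 * \<rho>" using * dist_triangle[of x2 x1 x] by (simp add: dist_commute)
      finally have "dist (x2, p2) (x1, p1) < 3 * \<rho>"
        using *(3) by (simp add: dist_commute)
      also have "\<dots> < d" using d(1) by (simp add: \<rho>_def)
      finally show ?thesis .
    qed
    ultimately have "\<bar>H x2 p2 - H x1 p1\<bar> < \<eta>" using d(2) by (fastforce simp: dist_real_def)
    then show "H x2 p2 \<le> a + \<eta>" using *(4) by linarith
  qed
qed

lemma sublevel_bounded:
  obtains K where "K > 0" "\<And>y p. norm y < R \<Longrightarrow> H y p \<le> a \<Longrightarrow> norm p \<le> K"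
proof -
  obtain K where "\<forall>y p. norm y < R \<longrightarrow> H y p \<le> a \<longrightarrow> norm p \<le> K" using H_coercive by blast
  then show thesis by (intro that[of "max K 1"]) (auto simp: le_max_iff_disj)
qed

lemma sublevel_closed: "closed {p. H x p \<le> b}"
proof -
  have "continuous_on UNIV (\<lambda>p. (\<lambda>(x, p). H x p) (x, p))"
    by (rule continuous_on_compose2[OF H_continuous]) (auto intro!: continuous_intros)
  then show ?thesis by (auto intro!: closed_Collect_le continuous_intros)
qed

lemma sublevel_convex: "convex {p. H x p \<le> b}"
  using H_convex[of x] unfolding convex_def convex_on_def
  by clarsimp (meson convex_bound_le order_trans)

text \<open>A closed convex set is the intersection of the half-spaces containing it. Half-spaces are
  preferred to the support function throughout, since they need no case distinction for empty
  sublevel sets.\<close>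

lemma sublevel_memI:
  assumes "\<And>q s. (\<And>p'. H x p' \<le> b \<Longrightarrow> p' \<bullet> q \<le> s) \<Longrightarrow> p \<bullet> q \<le> s"
  shows "H x p \<le> b"
proof (rule ccontr)
  assume "\<not> H x p \<le> b"
  then obtain q c where q: "q \<bullet> p < c" "\<And>p'. H x p' \<le> b \<Longrightarrow> q \<bullet> p' > c"
    using separating_hyperplane_closed_point[OF sublevel_convex[of x b] sublevel_closed[of x b], of p]
    by auto
  have "p \<bullet> (- q) \<le> - c" by (rule assms) (use q(2) in \<open>auto simp: inner_commute less_imp_le\<close>)
  with q(1) show False by (simp add: inner_commute)
qed

section \<open>Subsolutions as functions with bounded increments\<close>

text \<open>A mean value inequality. Let \<open>f \<xi>\<close> be the maximum over \<open>\<zeta>\<close> of \<open>u \<zeta> - n |\<zeta> - \<xi>|\<^sup>2\<close>, the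
  sup-convolution of \<open>u\<close>. If \<open>\<zeta>\<close> is the maximizer for \<open>\<xi>\<close>, then \<open>p = 2 n (\<zeta> - \<xi>)\<close> is the gradient
  of a quadratic function touching \<open>u\<close> from above at \<open>\<zeta>\<close>, hence \<open>p \<bullet> q \<le> s\<close> for \<open>q = z - y\<close>; and using
  the same \<open>\<zeta>\<close> as a competitor at \<open>\<xi> - h q\<close> gives \<open>f \<xi> - f (\<xi> - h q) \<le> h (p \<bullet> q) + n |q|\<^sup>2 h\<^sup>2\<close>. The
  error is quadratic in \<open>h\<close>, so summing along the segment yields \<open>f z - f y \<le> s\<close>, and \<open>f\<close> tends to
  \<open>u\<close> as \<open>n\<close> grows.\<close>

lemma subsolution_increment_le:
  assumes u: "viscosity_subsolution H a u"
    and grad: "\<And>\<xi> p. dist x \<xi> < \<rho> \<Longrightarrow> H \<xi> p \<le> a \<Longrightarrow> p \<bullet> (z - y) \<le> s"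
    and y: "dist x y < \<rho> / 2" and z: "dist x z < \<rho> / 2"
  shows "u z - u y \<le> s"
proof -
  define q where "q = z - y"
  have \<rho>: "\<rho> > 0" using y zero_le_dist[of x y] by linarith
  have cont: "continuous_on S u" for S
    using u continuous_on_subset unfolding viscosity_subsolution_def by blast
  have "bounded (u ` cball x \<rho>)"
    by (intro compact_imp_bounded compact_continuous_image cont compact_cball)
  then obtain B where B: "B > 0" "\<And>\<xi>. dist x \<xi> \<le> \<rho> \<Longrightarrow> \<bar>u \<xi>\<bar> \<le> B"
    unfolding bounded_pos by fastforce
  have approx: "u z - u y \<le> s + e" if e: "e > 0" for e
  proof -
    have "isCont u y" using cont[of UNIV] by (simp add: continuous_on_eq_continuous_at)
    then obtain d0 where d0: "d0 > 0" "\<And>\<xi>. dist \<xi> y < d0 \<Longrightarrow> dist (u \<xi>) (u y) < e"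
      using e unfolding continuous_at_eps_delta by blast
    define d where "d = min d0 (\<rho> / 2)"
    have d: "d > 0" using d0 \<rho> by (simp add: d_def)
    \<comment> \<open>This size of \<open>n\<close> makes moving by more than \<open>d\<close> cost more than the oscillation \<open>2 B\<close> of \<open>u\<close>.\<close>
    define n where "n = 3 * B / d\<^sup>2"
    have n: "n > 0" using B d by (simp add: n_def)
    have "\<exists>\<zeta>\<in>cball x \<rho>. \<forall>\<zeta>'\<in>cball x \<rho>. u \<zeta>' - n * (norm (\<zeta>' - \<xi>))\<^sup>2 \<le> u \<zeta> - n * (norm (\<zeta> - \<xi>))\<^sup>2" for \<xi>
      by (intro continuous_attains_sup continuous_intros cont) (use \<rho> in auto)
    then obtain m where m: "\<And>\<xi>. dist x (m \<xi>) \<le> \<rho>"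
      "\<And>\<xi> \<zeta>. dist x \<zeta> \<le> \<rho> \<Longrightarrow> u \<zeta> - n * (norm (\<zeta> - \<xi>))\<^sup>2 \<le> u (m \<xi>) - n * (norm (m \<xi> - \<xi>))\<^sup>2"
      by (metis mem_cball)
    define f where "f \<xi> = u (m \<xi>) - n * (norm (m \<xi> - \<xi>))\<^sup>2" for \<xi>
    have close: "norm (m \<xi> - \<xi>) < d" if "dist x \<xi> < \<rho> / 2" for \<xi>
    proof -
      have "n * (norm (m \<xi> - \<xi>))\<^sup>2 \<le> u (m \<xi>) - u \<xi>"
        using m(2)[of \<xi> \<xi>] that \<rho> by simp
      also have "\<dots> \<le> 2 * B" using B(2)[of \<xi>] B(2)[of "m \<xi>"] m(1)[of \<xi>] that \<rho> by fastforce
      also have "\<dots> < n * d\<^sup>2" using B d by (simp add: n_def)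
      finally have "(norm (m \<xi> - \<xi>))\<^sup>2 < d\<^sup>2" using n by simp
      then show ?thesis using d by (simp add: power2_less_imp_less)
    qed
    have "f (y + 1 *\<^sub>R q) - f (y + 0 *\<^sub>R q) \<le> s"
    proof (rule increment_le_of_quadratic_steps[where g = "\<lambda>t. f (y + t *\<^sub>R q)" and C = "n * (norm q)\<^sup>2"])
      fix t h :: real assume th: "0 \<le> t" "0 \<le> h" "t + h \<le> 1"
      define \<xi> where "\<xi> = y + (t + h) *\<^sub>R q"
      define p where "p = (2 * n) *\<^sub>R (m \<xi> - \<xi>)"
      have "\<xi> \<in> closed_segment y z"
        unfolding closed_segment_def \<xi>_def q_def using th by (auto intro!: exI[of _ "t + h"] simp: algebra_simps)
      moreover have "closed_segment y z \<subseteq> ball x (\<rho> / 2)"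
        by (intro closed_segment_subset) (use y z in auto)
      ultimately have \<xi>: "dist x \<xi> < \<rho> / 2" by auto
      have m\<xi>: "dist x (m \<xi>) < \<rho>"
      proof -
        have "dist x (m \<xi>) \<le> dist x \<xi> + dist \<xi> (m \<xi>)" by (rule dist_triangle)
        also have "dist \<xi> (m \<xi>) < \<rho> / 2"
          using close[OF \<xi>] by (simp add: dist_norm norm_minus_commute d_def)
        finally show ?thesis using \<xi> by simp
      qed
      have "H (m \<xi>) p \<le> a"
      proof -
        have "C1_with_gradient (\<lambda>w. n * (norm (w - \<xi>))\<^sup>2) (\<lambda>w. (2 * n) *\<^sub>R (w - \<xi>))"
          using C1_with_gradient_sum_of_squares[of n \<xi> 0 0] by simp
        moreover have "\<forall>\<^sub>F w in nhds (m \<xi>).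
            u w - n * (norm (w - \<xi>))\<^sup>2 \<le> u (m \<xi>) - n * (norm (m \<xi> - \<xi>))\<^sup>2"
        proof (rule eventually_mono[OF eventually_nhds_in_open[of "ball x \<rho>"]])
          show "m \<xi> \<in> ball x \<rho>" using m\<xi> by simp
        qed (use m(2) in auto)
        ultimately show ?thesis
          using u unfolding viscosity_subsolution_def p_def by blast
      qed
      then have pq: "h * (p \<bullet> q) \<le> h * s"
        using grad[OF m\<xi>] th by (auto simp: q_def intro: mult_left_mono)
      have "(norm (m \<xi> - (y + t *\<^sub>R q)))\<^sup>2 = (norm ((m \<xi> - \<xi>) + h *\<^sub>R q))\<^sup>2"
        by (simp add: \<xi>_def algebra_simps)
      also have "\<dots> = (norm (m \<xi> - \<xi>))\<^sup>2 + 2 * h * ((m \<xi> - \<xi>) \<bullet> q) + h\<^sup>2 * (norm q)\<^sup>2"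
        by (simp only: power2_norm_eq_inner) (simp add: algebra_simps inner_commute power2_eq_square)
      finally have sq: "(norm (m \<xi> - (y + t *\<^sub>R q)))\<^sup>2 - (norm (m \<xi> - \<xi>))\<^sup>2
          = 2 * h * ((m \<xi> - \<xi>) \<bullet> q) + h\<^sup>2 * (norm q)\<^sup>2"
        by linarith
      have "f \<xi> - f (y + t *\<^sub>R q)
          \<le> n * ((norm (m \<xi> - (y + t *\<^sub>R q)))\<^sup>2 - (norm (m \<xi> - \<xi>))\<^sup>2)"
        using m(2)[OF m(1)[of \<xi>], of "y + t *\<^sub>R q"] unfolding f_def right_diff_distrib by linarith
      also have "\<dots> = h * (p \<bullet> q) + n * (norm q)\<^sup>2 * h\<^sup>2"
        unfolding sq by (simp add: p_def algebra_simps)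
      finally show "f (y + (t + h) *\<^sub>R q) - f (y + t *\<^sub>R q) \<le> h * s + n * (norm q)\<^sup>2 * h\<^sup>2"
        using pq by (simp add: \<xi>_def)
    qed
    then have "f z - f y \<le> s" by (simp add: q_def)
    moreover have "u z \<le> f z" using m(2)[of z z] z \<rho> by (simp add: f_def)
    moreover have "f y \<le> u y + e"
    proof -
      have "dist (u (m y)) (u y) < e"
        using close[OF y] by (intro d0(2)) (simp add: dist_norm d_def)
      moreover have "n * (norm (m y - y))\<^sup>2 \<ge> 0" using n by simp
      ultimately show ?thesis unfolding f_def dist_real_def by linarith
    qed
    ultimately show ?thesis by linarith
  qed
  then show ?thesis by (rule field_le_epsilon)
qed

text \<open>The increments of \<open>u\<close> over \<open>S\<close> are bounded by the support function of the sublevel set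
  \<open>{p. H x p \<le> b}\<close>; the number \<open>s\<close> ranges over the upper bounds of \<open>p \<bullet> (z - y)\<close> on that set.\<close>

definition increments_bounded :: "'a \<Rightarrow> real \<Rightarrow> ('a \<Rightarrow> real) \<Rightarrow> 'a set \<Rightarrow> bool" where
  "increments_bounded x b u S \<longleftrightarrow>
     (\<forall>y\<in>S. \<forall>z\<in>S. \<forall>s. (\<forall>p. H x p \<le> b \<longrightarrow> p \<bullet> (z - y) \<le> s) \<longrightarrow> u z - u y \<le> s)"

definition frozen_subsolution :: "real \<Rightarrow> ('a \<Rightarrow> real) \<Rightarrow> 'a \<Rightarrow> bool" where
  "frozen_subsolution a u x \<longleftrightarrow> (\<forall>\<eta>>0. \<exists>r>0. increments_bounded x (a + \<eta>) u (ball x r))"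

definition strict_subsolution_at :: "('a \<Rightarrow> real) \<Rightarrow> 'a \<Rightarrow> bool" where
  "strict_subsolution_at u x \<longleftrightarrow> (\<exists>\<delta>>0. frozen_subsolution (- \<delta>) u x)"

lemma increments_boundedD:
  assumes "increments_bounded x b u S" "y \<in> S" "z \<in> S" "\<And>p. H x p \<le> b \<Longrightarrow> p \<bullet> (z - y) \<le> s"
  shows "u z - u y \<le> s"
  using assms unfolding increments_bounded_def by blast

lemma increments_bounded_mono:
  assumes "increments_bounded x b u S" "T \<subseteq> S" "b \<le> b'"
  shows "increments_bounded x b' u T"
  unfolding increments_bounded_def
proof (intro ballI allI impI)
  fix y z s assume *: "y \<in> T" "z \<in> T" "\<forall>p. H x p \<le> b' \<longrightarrow> p \<bullet> (z - y) \<le> s"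
  show "u z - u y \<le> s"
    by (rule increments_boundedD[OF assms(1)]) (use * assms in \<open>auto intro: order_trans\<close>)
qed

text \<open>The radius does not depend on \<open>u\<close>, which is what makes the supremum \<open>S\<^sub>0\<close> of subsolutions
  a subsolution.\<close>

lemma subsolution_increments_bounded_uniformly:
  assumes "\<eta> > 0"
  obtains r where "r > 0"
    "\<And>u. viscosity_subsolution H a u \<Longrightarrow> increments_bounded x (a + \<eta>) u (ball x r)"
proof -
  obtain \<rho> where \<rho>: "\<rho> > 0" "\<And>x1 x2 p1 p2. dist x x1 < \<rho> \<Longrightarrow> dist x x2 < \<rho> \<Longrightarrow> dist p1 p2 < \<rho> \<Longrightarrow>
      H x1 p1 \<le> a \<Longrightarrow> H x2 p2 \<le> a + \<eta>"
    using sublevel_perturbation[OF assms, of x a] by blast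
  show thesis
  proof
    show "\<rho> / 2 > 0" using \<rho> by simp
    fix u assume u: "viscosity_subsolution H a u"
    show "increments_bounded x (a + \<eta>) u (ball x (\<rho> / 2))"
      unfolding increments_bounded_def
    proof (intro ballI allI impI)
      fix y z s
      assume "y \<in> ball x (\<rho> / 2)" "z \<in> ball x (\<rho> / 2)"
        and s: "\<forall>p. H x p \<le> a + \<eta> \<longrightarrow> p \<bullet> (z - y) \<le> s"
      then show "u z - u y \<le> s"
      proof (intro subsolution_increment_le[OF u, of x \<rho>])
        fix \<xi> p assume "dist x \<xi> < \<rho>" "H \<xi> p \<le> a"
        then have "H x p \<le> a + \<eta>" using \<rho>(2)[of \<xi> x p p] \<rho>(1) by simp
        then show "p \<bullet> (z - y) \<le> s" using s by blast
      qed auto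
    qed
  qed
qed

lemma frozen_subsolution_if_subsolution:
  assumes "viscosity_subsolution H a u"
  shows "frozen_subsolution a u x"
  unfolding frozen_subsolution_def
  using subsolution_increments_bounded_uniformly[of _ a x] assms by metis

text \<open>Over an empty sublevel set every number bounds the increments, also the increment \<open>0\<close> from
  \<open>y\<close> to \<open>y\<close>.\<close>

lemma sublevel_nonempty_if_increments_bounded:
  assumes "increments_bounded x b u S" "y \<in> S"
  shows "\<exists>p. H x p \<le> b"
proof (rule ccontr)
  assume "\<nexists>p. H x p \<le> b"
  then have "u y - u y \<le> -1"
    by (intro increments_boundedD[OF assms(1,2,2)]) auto
  then show False by simp
qed

lemma increments_bounded_Lipschitz:
  obtains K where "K > 0"
    "\<And>u S y z. increments_bounded x b u S \<Longrightarrow> y \<in> S \<Longrightarrow> z \<in> S \<Longrightarrow> \<bar>u z - u y\<bar> \<le> K * dist y z"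
proof -
  obtain K where K: "K > 0" "\<And>y p. norm y < norm x + 1 \<Longrightarrow> H y p \<le> b \<Longrightarrow> norm p \<le> K"
    using sublevel_bounded[of "norm x + 1" b] by blast
  have one: "u z - u y \<le> K * dist y z"
    if "increments_bounded x b u S" "y \<in> S" "z \<in> S" for u S y z
  proof (rule increments_boundedD[OF that])
    fix p assume "H x p \<le> b"
    then have "norm p * norm (z - y) \<le> K * norm (z - y)"
      using K(2)[of x p] by (intro mult_right_mono) auto
    then show "p \<bullet> (z - y) \<le> K * dist y z"
      using norm_cauchy_schwarz[of p "z - y"] by (simp add: dist_norm norm_minus_commute)
  qed
  show thesis
  proof (rule that[OF K(1)])
    fix u S y z assume "increments_bounded x b u S" "y \<in> S" "z \<in> S"
    then show "\<bar>u z - u y\<bar> \<le> K * dist y z"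
      using one[of u S y z] one[of u S z y] by (auto simp: dist_commute abs_le_iff)
  qed
qed

lemma frozen_subsolution_isCont:
  assumes "frozen_subsolution a u x"
  shows "isCont u x"
proof -
  obtain r where r: "r > 0" "increments_bounded x (a + 1) u (ball x r)"
    using assms unfolding frozen_subsolution_def by (meson zero_less_one)
  obtain K where K: "K > 0" "\<And>u S y z. increments_bounded x (a + 1) u S \<Longrightarrow> y \<in> S \<Longrightarrow> z \<in> S \<Longrightarrow>
      \<bar>u z - u y\<bar> \<le> K * dist y z"
    using increments_bounded_Lipschitz by blast
  show ?thesis
    unfolding continuous_at_eps_delta
  proof (intro allI impI)
    fix e :: real assume e: "e > 0"
    show "\<exists>d>0. \<forall>y. dist y x < d \<longrightarrow> dist (u y) (u x) < e"
    proof (intro exI[of _ "min r (e / K)"] conjI allI impI)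
      fix y assume y: "dist y x < min r (e / K)"
      have "\<bar>u y - u x\<bar> \<le> K * dist x y"
        by (rule K(2)[OF r(2)]) (use y r in \<open>auto simp: dist_commute\<close>)
      also have "\<dots> < e" using y K(1) by (simp add: dist_commute field_simps)
      finally show "dist (u y) (u x) < e" by (simp add: dist_real_def)
    qed (use r K e in auto)
  qed
qed

text \<open>Moving from \<open>\<zeta>\<close> by \<open>- t q\<close> the test function decreases at most as much as \<open>u\<close> does, that
  is by at most \<open>t s\<close> for each half-space \<open>p' \<bullet> q \<le> s\<close> containing the sublevel set; so \<open>p\<close> lies in
  all these half-spaces. The sublevel set is the one at \<open>x\<close>, although the contact is at \<open>\<zeta>\<close>.\<close>

lemma test_gradient_in_sublevel:
  assumes incr: "increments_bounded x b u (ball x r)"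
    and \<zeta>: "\<zeta> \<in> ball x r"
    and deriv: "GDERIV \<phi> \<zeta> :> p"
    and touch: "\<forall>\<^sub>F y in nhds \<zeta>. u y - \<phi> y \<le> u \<zeta> - \<phi> \<zeta>"
  shows "H x p \<le> b"
proof (rule sublevel_memI, rule ccontr)
  fix q s
  assume s: "\<And>p'. H x p' \<le> b \<Longrightarrow> p' \<bullet> q \<le> s" and "\<not> p \<bullet> q \<le> s"
  define g where "g t = \<phi> (\<zeta> - t *\<^sub>R q) + t * s" for t :: real
  have "(g has_derivative (\<lambda>t. (- (t *\<^sub>R q)) \<bullet> p + t * s)) (at 0)"
  proof -
    have "(\<phi> has_derivative (\<lambda>h. h \<bullet> p)) (at (\<zeta> - 0 *\<^sub>R q))"
      using deriv by (simp add: gderiv_def)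
    then have "((\<lambda>t. \<phi> (\<zeta> - t *\<^sub>R q)) has_derivative (\<lambda>t. (- (t *\<^sub>R q)) \<bullet> p)) (at 0)"
      by (rule has_derivative_compose[rotated]) (auto intro!: derivative_eq_intros)
    then show ?thesis
      unfolding g_def[abs_def] by (auto intro!: derivative_eq_intros)
  qed
  then have "DERIV g 0 :> s - p \<bullet> q"
    unfolding has_field_derivative_def
    by (rule has_derivative_eq_rhs) (simp add: fun_eq_iff inner_commute algebra_simps)
  moreover have "s - p \<bullet> q < 0" using \<open>\<not> p \<bullet> q \<le> s\<close> by simp
  ultimately obtain d where d: "d > 0" "\<And>t. 0 < t \<Longrightarrow> t < d \<Longrightarrow> g t < g 0"
    by (metis DERIV_neg_dec_right add_0)
  obtain T where T: "open T" "\<zeta> \<in> T" "\<And>y. y \<in> T \<Longrightarrow> u y - \<phi> y \<le> u \<zeta> - \<phi> \<zeta>"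
    using touch unfolding eventually_nhds by blast
  have "open (T \<inter> ball x r)" "\<zeta> \<in> T \<inter> ball x r" using T \<zeta> by auto
  then obtain e where e: "e > 0" "ball \<zeta> e \<subseteq> T \<inter> ball x r" using open_contains_ball by blast
  define t where "t = min (d / 2) (e / (2 * (norm q + 1)))"
  have "0 < e / (2 * (norm q + 1))"
    using e(1) by (intro divide_pos_pos) (auto intro: add_nonneg_pos)
  then have t: "0 < t" "t < d" using d(1) by (auto simp: t_def)
  have "t * norm q \<le> t * (norm q + 1)" using t by simp
  also have "\<dots> \<le> e / (2 * (norm q + 1)) * (norm q + 1)"
    by (intro mult_right_mono) (auto simp: t_def)
  also have "\<dots> = e / 2"
  proof -
    have "norm q + 1 \<noteq> 0" using norm_ge_zero[of q] by linarith
    then show ?thesis by (simp add: divide_simps)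
  qed
  also have "\<dots> < e" using e(1) by simp
  finally have "\<zeta> - t *\<^sub>R q \<in> ball \<zeta> e" using t by (simp add: dist_norm)
  then have y: "\<zeta> - t *\<^sub>R q \<in> T" "\<zeta> - t *\<^sub>R q \<in> ball x r" using e(2) by blast+
  have "u \<zeta> - u (\<zeta> - t *\<^sub>R q) \<le> t * s"
    by (rule increments_boundedD[OF incr y(2) \<zeta>]) (use s t in auto)
  then have "g t \<ge> g 0" using T(3)[OF y(1)] by (simp add: g_def)
  with d(2)[OF t] show False by simp
qed

lemma subsolution_if_frozen_subsolution:
  assumes "\<And>x. frozen_subsolution a u x"
  shows "viscosity_subsolution H a u"
  unfolding viscosity_subsolution_def
proof (intro conjI allI impI)
  show "continuous_on UNIV u"
    using frozen_subsolution_isCont[OF assms] by (simp add: continuous_on_eq_continuous_at)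
  fix \<phi> G x
  assume \<phi>: "C1_with_gradient \<phi> G" "\<forall>\<^sub>F y in nhds x. u y - \<phi> y \<le> u x - \<phi> x"
  show "H x (G x) \<le> a"
  proof (rule field_le_epsilon)
    fix \<eta> :: real assume "\<eta> > 0"
    then obtain r where "r > 0" "increments_bounded x (a + \<eta>) u (ball x r)"
      using assms unfolding frozen_subsolution_def by blast
    then show "H x (G x) \<le> a + \<eta>"
      using test_gradient_in_sublevel \<phi> unfolding C1_with_gradient_def
      by (metis centre_in_ball)
  qed
qed

section \<open>Operations on subsolutions\<close>

lemma frozen_subsolution_local:
  assumes "frozen_subsolution a u x" "\<forall>\<^sub>F y in nhds x. u y = w y"
  shows "frozen_subsolution a w x"
  unfolding frozen_subsolution_def
proof (intro allI impI)
  fix \<eta> :: real assume "\<eta> > 0"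
  then obtain r where r: "r > 0" "increments_bounded x (a + \<eta>) u (ball x r)"
    using assms(1) unfolding frozen_subsolution_def by blast
  obtain d where d: "d > 0" "\<And>y. dist y x < d \<Longrightarrow> u y = w y"
    using assms(2) unfolding eventually_nhds_metric by blast
  have "increments_bounded x (a + \<eta>) u (ball x (min r d))"
    using r(2) by (rule increments_bounded_mono) auto
  then have "increments_bounded x (a + \<eta>) w (ball x (min r d))"
    unfolding increments_bounded_def using d(2) by (auto simp: dist_commute)
  then show "\<exists>r>0. increments_bounded x (a + \<eta>) w (ball x r)"
    using r(1) d(1) by (intro exI[of _ "min r d"]) auto
qed

lemma frozen_subsolution_mono:
  assumes "frozen_subsolution a u x" "a \<le> b"
  shows "frozen_subsolution b u x"
  using assms unfolding frozen_subsolution_def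
  by (meson add_right_mono increments_bounded_mono order_refl)

lemma frozen_subsolution_shift:
  assumes "frozen_subsolution a u x"
  shows "frozen_subsolution a (\<lambda>y. u y + c) x"
  using assms unfolding frozen_subsolution_def increments_bounded_def by simp

lemma frozen_subsolution_common_ball:
  assumes "frozen_subsolution a u x" "frozen_subsolution b w x" "\<eta> > 0"
  obtains r where "r > 0" "increments_bounded x (a + \<eta>) u (ball x r)"
    "increments_bounded x (b + \<eta>) w (ball x r)"
proof -
  obtain r1 r2 where r: "r1 > 0" "increments_bounded x (a + \<eta>) u (ball x r1)"
    "r2 > 0" "increments_bounded x (b + \<eta>) w (ball x r2)"
    using assms unfolding frozen_subsolution_def by meson
  show thesis
    by (rule that[of "min r1 r2"]) (use r in \<open>auto elim!: increments_bounded_mono\<close>)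
qed

lemma frozen_subsolution_max:
  assumes "frozen_subsolution a u x" "frozen_subsolution a w x"
  shows "frozen_subsolution a (\<lambda>y. max (u y) (w y)) x"
  unfolding frozen_subsolution_def
proof (intro allI impI)
  fix \<eta> :: real assume "\<eta> > 0"
  with assms obtain r where r: "r > 0" "increments_bounded x (a + \<eta>) u (ball x r)"
    "increments_bounded x (a + \<eta>) w (ball x r)"
    by (rule frozen_subsolution_common_ball)
  have "increments_bounded x (a + \<eta>) (\<lambda>y. max (u y) (w y)) (ball x r)"
    unfolding increments_bounded_def
  proof (intro ballI allI impI)
    fix y z s assume *: "y \<in> ball x r" "z \<in> ball x r" "\<forall>p. H x p \<le> a + \<eta> \<longrightarrow> p \<bullet> (z - y) \<le> s"
    have "u z - u y \<le> s" "w z - w y \<le> s"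
      using r(2,3) * unfolding increments_bounded_def by blast+
    then show "max (u z) (w z) - max (u y) (w y) \<le> s" by linarith
  qed
  then show "\<exists>r>0. increments_bounded x (a + \<eta>) (\<lambda>y. max (u y) (w y)) (ball x r)"
    using r(1) by blast
qed

lemma frozen_subsolution_min:
  assumes "frozen_subsolution a u x" "frozen_subsolution a w x"
  shows "frozen_subsolution a (\<lambda>y. min (u y) (w y)) x"
  unfolding frozen_subsolution_def
proof (intro allI impI)
  fix \<eta> :: real assume "\<eta> > 0"
  with assms obtain r where r: "r > 0" "increments_bounded x (a + \<eta>) u (ball x r)"
    "increments_bounded x (a + \<eta>) w (ball x r)"
    by (rule frozen_subsolution_common_ball)
  have "increments_bounded x (a + \<eta>) (\<lambda>y. min (u y) (w y)) (ball x r)"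
    unfolding increments_bounded_def
  proof (intro ballI allI impI)
    fix y z s assume *: "y \<in> ball x r" "z \<in> ball x r" "\<forall>p. H x p \<le> a + \<eta> \<longrightarrow> p \<bullet> (z - y) \<le> s"
    have "u z - u y \<le> s" "w z - w y \<le> s"
      using r(2,3) * unfolding increments_bounded_def by blast+
    then show "min (u z) (w z) - min (u y) (w y) \<le> s" by linarith
  qed
  then show "\<exists>r>0. increments_bounded x (a + \<eta>) (\<lambda>y. min (u y) (w y)) (ball x r)"
    using r(1) by blast
qed

text \<open>If \<open>p1\<close> and \<open>p2\<close> lie in the two sublevel sets, then by convexity of \<open>H x\<close> their
  combination lies in the sublevel set of the combined level. Eliminating first \<open>p1\<close> and then \<open>p2\<close>
  from the resulting inequality bounds the increments of \<open>u\<close> and \<open>w\<close> in turn.\<close>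

lemma frozen_subsolution_convex_combination:
  assumes u: "frozen_subsolution a u x" and w: "frozen_subsolution b w x"
    and l: "0 < l" "l < 1"
  shows "frozen_subsolution ((1 - l) * a + l * b) (\<lambda>y. (1 - l) * u y + l * w y) x"
  unfolding frozen_subsolution_def
proof (intro allI impI)
  fix \<eta> :: real assume "\<eta> > 0"
  with u w obtain r where r: "r > 0" "increments_bounded x (a + \<eta>) u (ball x r)"
    "increments_bounded x (b + \<eta>) w (ball x r)"
    by (rule frozen_subsolution_common_ball)
  have "increments_bounded x ((1 - l) * a + l * b + \<eta>) (\<lambda>y. (1 - l) * u y + l * w y) (ball x r)"
    unfolding increments_bounded_def
  proof (intro ballI allI impI)
    fix y z s
    assume y: "y \<in> ball x r" and z: "z \<in> ball x r"
      and s: "\<forall>p. H x p \<le> (1 - l) * a + l * b + \<eta> \<longrightarrow> p \<bullet> (z - y) \<le> s"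
    have comb: "(1 - l) * (p1 \<bullet> (z - y)) + l * (p2 \<bullet> (z - y)) \<le> s"
      if p: "H x p1 \<le> a + \<eta>" "H x p2 \<le> b + \<eta>" for p1 p2
    proof -
      have "H x ((1 - l) *\<^sub>R p1 + l *\<^sub>R p2) \<le> (1 - l) * H x p1 + l * H x p2"
        by (rule convex_onD[OF H_convex]) (use l in auto)
      also have "\<dots> \<le> (1 - l) * (a + \<eta>) + l * (b + \<eta>)"
        using p l by (intro add_mono mult_left_mono) auto
      also have "\<dots> = (1 - l) * a + l * b + \<eta>" by (simp add: algebra_simps)
      finally have "((1 - l) *\<^sub>R p1 + l *\<^sub>R p2) \<bullet> (z - y) \<le> s" using s by blast
      then show ?thesis by (simp only: inner_add_left inner_scaleR_left)
    qed
    have "w z - w y \<le> (s - (1 - l) * (u z - u y)) / l"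
    proof (rule increments_boundedD[OF r(3) y z])
      fix p2 assume p2: "H x p2 \<le> b + \<eta>"
      have "u z - u y \<le> (s - l * (p2 \<bullet> (z - y))) / (1 - l)"
      proof (rule increments_boundedD[OF r(2) y z])
        fix p1 assume "H x p1 \<le> a + \<eta>"
        from comb[OF this p2] show "p1 \<bullet> (z - y) \<le> (s - l * (p2 \<bullet> (z - y))) / (1 - l)"
          using l by (simp add: pos_le_divide_eq mult.commute)
      qed
      then have "(1 - l) * (u z - u y) + l * (p2 \<bullet> (z - y)) \<le> s"
        using l by (simp add: pos_le_divide_eq mult.commute)
      then show "p2 \<bullet> (z - y) \<le> (s - (1 - l) * (u z - u y)) / l"
        using l by (simp add: pos_le_divide_eq mult.commute)
    qed
    then have "(1 - l) * (u z - u y) + l * (w z - w y) \<le> s"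
      using l by (simp add: pos_le_divide_eq mult.commute)
    then show "(1 - l) * u z + l * w z - ((1 - l) * u y + l * w y) \<le> s"
      by (simp add: algebra_simps)
  qed
  then show "\<exists>r>0. increments_bounded x ((1 - l) * a + l * b + \<eta>) (\<lambda>y. (1 - l) * u y + l * w y) (ball x r)"
    using r(1) by blast
qed

text \<open>The increments near \<open>x\<close> are controlled by the sublevel set at \<open>x\<close>, which is contained in
  the sublevel set of a slightly higher, still negative, level at any nearby point.\<close>

lemma strict_subsolution_at_open: "open {x. strict_subsolution_at u x}"
  unfolding open_dist
proof (intro ballI)
  fix x assume "x \<in> {x. strict_subsolution_at u x}"
  then obtain \<delta> where \<delta>: "\<delta> > 0" "frozen_subsolution (- \<delta>) u x"
    unfolding strict_subsolution_at_def by blast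
  then have "\<delta> / 3 > 0" by simp
  then obtain r where r: "r > 0" "increments_bounded x (- \<delta> + \<delta> / 3) u (ball x r)"
    using \<delta>(2) unfolding frozen_subsolution_def by blast
  obtain \<rho> where \<rho>: "\<rho> > 0" "\<And>x1 x2 p1 p2. dist x x1 < \<rho> \<Longrightarrow> dist x x2 < \<rho> \<Longrightarrow> dist p1 p2 < \<rho> \<Longrightarrow>
      H x1 p1 \<le> - \<delta> + \<delta> / 3 \<Longrightarrow> H x2 p2 \<le> - \<delta> + \<delta> / 3 + \<delta> / 3"
    using sublevel_perturbation[OF \<open>\<delta> / 3 > 0\<close>, of x "- \<delta> + \<delta> / 3"] by blast
  have "strict_subsolution_at u y" if y: "dist y x < min r \<rho>" for y
  proof -
    define r' where "r' = r - dist x y"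
    have r': "r' > 0" "ball y r' \<subseteq> ball x r"
      using y dist_triangle_less_add[of x y] by (auto simp: r'_def dist_commute ball_subset_ball_iff intro!: subset_ball)
    have "increments_bounded y (- (\<delta> / 3)) u (ball y r')"
      unfolding increments_bounded_def
    proof (intro ballI allI impI)
      fix z1 z2 s
      assume *: "z1 \<in> ball y r'" "z2 \<in> ball y r'" "\<forall>p. H y p \<le> - (\<delta> / 3) \<longrightarrow> p \<bullet> (z2 - z1) \<le> s"
      show "u z2 - u z1 \<le> s"
      proof (rule increments_boundedD[OF r(2)])
        fix p assume "H x p \<le> - \<delta> + \<delta> / 3"
        then have "H y p \<le> - \<delta> + \<delta> / 3 + \<delta> / 3"
          using \<rho>(2)[of x y p p] y \<rho>(1) by (simp add: dist_commute)
        then have "H y p \<le> - (\<delta> / 3)" using \<delta>(1) by (simp add: field_simps)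
        then show "p \<bullet> (z2 - z1) \<le> s" using * by blast
      qed (use * r' in auto)
    qed
    then have "frozen_subsolution (- (\<delta> / 3)) u y"
      unfolding frozen_subsolution_def
      using r'(1) by (meson increments_bounded_mono less_add_same_cancel1 less_imp_le order_refl)
    then show ?thesis using \<open>\<delta> / 3 > 0\<close> unfolding strict_subsolution_at_def by blast
  qed
  then show "\<exists>e>0. \<forall>y. dist y x < e \<longrightarrow> y \<in> {x. strict_subsolution_at u x}"
    using r(1) \<rho>(1) by (intro exI[of _ "min r \<rho>"]) auto
qed

lemma frozen_subsolution_C1:
  assumes \<phi>: "C1_with_gradient \<phi> G" and "H x (G x) \<le> a"
  shows "frozen_subsolution a \<phi> x"
  unfolding frozen_subsolution_def
proof (intro allI impI)
  fix \<eta> :: real assume "\<eta> > 0"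
  then obtain \<rho> where \<rho>: "\<rho> > 0" "\<And>x1 x2 p1 p2. dist x x1 < \<rho> \<Longrightarrow> dist x x2 < \<rho> \<Longrightarrow> dist p1 p2 < \<rho> \<Longrightarrow>
      H x1 p1 \<le> a \<Longrightarrow> H x2 p2 \<le> a + \<eta>"
    using sublevel_perturbation[of \<eta> x a] by blast
  have "isCont G x" using \<phi> by (simp add: C1_with_gradient_def continuous_on_eq_continuous_at)
  then obtain r where r: "r > 0" "\<And>\<xi>. dist \<xi> x < r \<Longrightarrow> dist (G \<xi>) (G x) < \<rho>"
    using \<rho>(1) unfolding continuous_at_eps_delta by blast
  have "increments_bounded x (a + \<eta>) \<phi> (ball x r)"
    unfolding increments_bounded_def
  proof (intro ballI allI impI)
    fix y z s
    assume y: "y \<in> ball x r" and z: "z \<in> ball x r"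
      and s: "\<forall>p. H x p \<le> a + \<eta> \<longrightarrow> p \<bullet> (z - y) \<le> s"
    have "((\<lambda>t. \<phi> (y + t *\<^sub>R (z - y))) has_derivative (\<lambda>h. (h *\<^sub>R (z - y)) \<bullet> G (y + t *\<^sub>R (z - y)))) (at t)"
      for t
    proof -
      have "(\<phi> has_derivative (\<lambda>h. h \<bullet> G (y + t *\<^sub>R (z - y)))) (at (y + t *\<^sub>R (z - y)))"
        using \<phi> by (simp add: C1_with_gradient_def gderiv_def)
      then show ?thesis
        by (rule has_derivative_compose[rotated]) (auto intro!: derivative_eq_intros)
    qed
    then have "\<exists>t\<in>{0<..<1}. \<phi> (y + 1 *\<^sub>R (z - y)) - \<phi> (y + 0 *\<^sub>R (z - y))
        = ((1 - 0) *\<^sub>R (z - y)) \<bullet> G (y + t *\<^sub>R (z - y))"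
      by (intro mvt_simple) (auto intro: has_derivative_at_withinI)
    then obtain t where t: "0 < t" "t < 1" "\<phi> z - \<phi> y = (z - y) \<bullet> G (y + t *\<^sub>R (z - y))"
      by auto
    define \<xi> where "\<xi> = y + t *\<^sub>R (z - y)"
    have "\<xi> \<in> closed_segment y z"
      unfolding closed_segment_def \<xi>_def using t by (auto intro!: exI[of _ t] simp: algebra_simps)
    moreover have "closed_segment y z \<subseteq> ball x r"
      by (intro closed_segment_subset) (use y z in auto)
    ultimately have "dist \<xi> x < r" by (auto simp: dist_commute)
    then have "H x (G \<xi>) \<le> a + \<eta>"
      using \<rho>(2)[of x x "G x" "G \<xi>"] r(2) \<rho>(1) assms(2) by (simp add: dist_commute)
    then show "\<phi> z - \<phi> y \<le> s" using s t(3) by (simp add: \<xi>_def inner_commute[of "z - y"])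
  qed
  then show "\<exists>r>0. increments_bounded x (a + \<eta>) \<phi> (ball x r)" using r(1) by blast
qed

section \<open>Comparison with strict subsolutions\<close>

text \<open>Doubling of variables. Minimize \<open>v \<xi> - w \<zeta> + n |\<xi> - \<zeta>|\<^sup>2 + |\<xi> - x|\<^sup>2\<close> near \<open>x\<close>. At the
  minimum \<open>w\<close> is touched from above with gradient \<open>p = 2 n (\<zeta> - \<xi>)\<close> and \<open>v\<close> from below with
  \<open>p - 2 (\<xi> - x)\<close>. Since \<open>w\<close> is Lipschitz near \<open>x\<close>, both points tend to \<open>x\<close> as \<open>n\<close> grows, so the two
  gradients cannot satisfy inequalities for \<open>H\<close> that are apart by a fixed amount.\<close>

lemma supersolution_not_touched_by_strict_subsolution:
  assumes v: "viscosity_supersolution H 0 v"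
    and w: "strict_subsolution_at w x"
    and touch: "\<forall>\<^sub>F y in nhds x. v x - w x \<le> v y - w y"
  shows False
proof -
  obtain \<delta> where \<delta>: "\<delta> > 0" "frozen_subsolution (- \<delta>) w x"
    using w unfolding strict_subsolution_at_def by blast
  define b where "b = - \<delta> + \<delta> / 3"
  have \<delta>3: "\<delta> / 3 > 0" using \<delta> by simp
  then obtain r1 where r1: "r1 > 0" "increments_bounded x b w (ball x r1)"
    using \<delta>(2) unfolding frozen_subsolution_def b_def by blast
  obtain K where K: "K > 0" "\<And>u S y z. increments_bounded x b u S \<Longrightarrow> y \<in> S \<Longrightarrow> z \<in> S \<Longrightarrow>
      \<bar>u z - u y\<bar> \<le> K * dist y z"
    using increments_bounded_Lipschitz by blast
  obtain \<rho> where \<rho>: "\<rho> > 0" "\<And>x1 x2 p1 p2. dist x x1 < \<rho> \<Longrightarrow> dist x x2 < \<rho> \<Longrightarrow> dist p1 p2 < \<rho> \<Longrightarrow>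
      H x1 p1 \<le> b \<Longrightarrow> H x2 p2 \<le> b + \<delta> / 3"
    using sublevel_perturbation[OF \<delta>3, of x b] by blast
  obtain d where d: "d > 0" "\<And>y. dist y x < d \<Longrightarrow> v x - w x \<le> v y - w y"
    using touch unfolding eventually_nhds_metric by blast
  define r where "r = min r1 (min d \<rho>) / 2"
  have r: "r > 0" "r < r1" "r < d" "r < \<rho>" using r1 d \<rho> by (auto simp: r_def)
  \<comment> \<open>Comparing with \<open>\<xi> = \<zeta> = x\<close> gives \<open>|\<xi> - \<zeta>| \<le> K / n\<close> and \<open>|\<xi> - x|\<^sup>2 \<le> K\<^sup>2 / n\<close>; for this \<open>n\<close> both
      points are interior to the ball of radius \<open>r\<close>.\<close>
  define n where "n = 2 * K / r + 4 * K\<^sup>2 / r\<^sup>2 + 1"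
  have n0: "2 * K / r > 0" "4 * K\<^sup>2 / r\<^sup>2 > 0" using K r by simp_all
  then have n: "n > 0" by (simp add: n_def)
  have "n > 2 * K / r" "n > 4 * K\<^sup>2 / r\<^sup>2" using n0 unfolding n_def by linarith+
  then have nK: "K / n < r / 2" "K\<^sup>2 / n < (r / 2)\<^sup>2"
    using n r by (simp_all add: field_simps)
  have contv: "continuous_on S v" for S
    using v continuous_on_subset unfolding viscosity_supersolution_def by blast
  have contw: "continuous_on (cball x r) w"
  proof (rule lipschitz_on_continuous_on[of K], rule lipschitz_onI)
    fix y z assume "y \<in> cball x r" "z \<in> cball x r"
    then show "dist (w y) (w z) \<le> K * dist y z"
      using K(2)[OF r1(2), of y z] r by (auto simp: dist_real_def abs_minus_commute)
  qed (use K in simp)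
  let ?\<Phi> = "\<lambda>c. v (fst c) - w (snd c) + n * (norm (fst c - snd c))\<^sup>2 + (norm (fst c - x))\<^sup>2"
  have "\<exists>c\<in>cball x r \<times> cball x r. \<forall>c'\<in>cball x r \<times> cball x r. ?\<Phi> c \<le> ?\<Phi> c'"
  proof (rule continuous_attains_inf)
    show "continuous_on (cball x r \<times> cball x r) ?\<Phi>"
      by (intro continuous_intros continuous_on_compose2[OF contv[of UNIV]] continuous_on_compose2[OF contw])
        auto
  qed (use r in \<open>auto intro: compact_Times\<close>)
  then obtain \<xi> \<zeta> where \<xi>: "dist x \<xi> \<le> r" and \<zeta>: "dist x \<zeta> \<le> r"
    and least: "\<And>y z. dist x y \<le> r \<Longrightarrow> dist x z \<le> r \<Longrightarrow>
      v \<xi> - w \<zeta> + n * (norm (\<xi> - \<zeta>))\<^sup>2 + (norm (\<xi> - x))\<^sup>2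
      \<le> v y - w z + n * (norm (y - z))\<^sup>2 + (norm (y - x))\<^sup>2"
    by fastforce
  have "v \<xi> - w \<zeta> + n * (norm (\<xi> - \<zeta>))\<^sup>2 + (norm (\<xi> - x))\<^sup>2 \<le> v x - w x"
    using least[of x x] r by simp
  also have "\<dots> \<le> v \<xi> - w \<xi>" using d(2) \<xi> r by (simp add: dist_commute)
  finally have "n * (norm (\<xi> - \<zeta>))\<^sup>2 + (norm (\<xi> - x))\<^sup>2 \<le> w \<zeta> - w \<xi>" by simp
  also have "\<dots> \<le> K * norm (\<xi> - \<zeta>)"
    using K(2)[OF r1(2), of \<xi> \<zeta>] \<xi> \<zeta> r by (simp add: dist_norm)
  finally have key: "n * (norm (\<xi> - \<zeta>))\<^sup>2 + (norm (\<xi> - x))\<^sup>2 \<le> K * norm (\<xi> - \<zeta>)" .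
  have gap: "norm (\<xi> - \<zeta>) \<le> K / n"
  proof (cases "norm (\<xi> - \<zeta>) = 0")
    case False
    have "(n * norm (\<xi> - \<zeta>)) * norm (\<xi> - \<zeta>) \<le> K * norm (\<xi> - \<zeta>)"
      using key zero_le_power2[of "norm (\<xi> - x)"] by (simp only: power2_eq_square mult.assoc)
    then have "n * norm (\<xi> - \<zeta>) \<le> K" using False by (simp add: mult_le_cancel_right)
    then show ?thesis using n by (simp add: field_simps)
  qed (use K n in simp)
  have "(norm (\<xi> - x))\<^sup>2 \<le> K * norm (\<xi> - \<zeta>)"
    using key n by (smt (verit) mult_nonneg_nonneg zero_le_power2)
  also have "\<dots> \<le> K * (K / n)" using gap K by (intro mult_left_mono) auto
  also have "\<dots> < (r / 2)\<^sup>2" using nK by (simp add: power2_eq_square)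
  finally have \<xi>x: "norm (\<xi> - x) < r / 2"
    by (rule power2_less_imp_less) (use r in simp)
  have \<zeta>x: "norm (\<zeta> - x) < r"
  proof -
    have "norm (\<zeta> - x) \<le> norm (\<xi> - \<zeta>) + norm (\<xi> - x)"
      using norm_triangle_ineq[of "\<zeta> - \<xi>" "\<xi> - x"] by (simp add: norm_minus_commute)
    then show ?thesis using gap nK(1) \<xi>x by linarith
  qed
  define p where "p = (2 * n) *\<^sub>R (\<zeta> - \<xi>)"
  have Hw: "H x p \<le> b"
  proof (rule test_gradient_in_sublevel[OF r1(2)])
    show "\<zeta> \<in> ball x r1" using \<zeta> r by simp
    show "GDERIV (\<lambda>z. n * (norm (z - \<xi>))\<^sup>2) \<zeta> :> p"
      using C1_with_gradient_sum_of_squares[of n \<xi> 0 0]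
      by (simp add: C1_with_gradient_def p_def)
    show "\<forall>\<^sub>F z in nhds \<zeta>. w z - n * (norm (z - \<xi>))\<^sup>2 \<le> w \<zeta> - n * (norm (\<zeta> - \<xi>))\<^sup>2"
    proof (rule eventually_mono[OF eventually_nhds_in_open[of "ball x r"]])
      fix z assume "z \<in> ball x r"
      then show "w z - n * (norm (z - \<xi>))\<^sup>2 \<le> w \<zeta> - n * (norm (\<zeta> - \<xi>))\<^sup>2"
        using least[OF \<xi>, of z] by (simp add: norm_minus_commute)
    qed (use \<zeta>x in \<open>auto simp: dist_norm norm_minus_commute\<close>)
  qed
  define p' where "p' = (2 * (- n)) *\<^sub>R (\<xi> - \<zeta>) + (2 * (- 1)) *\<^sub>R (\<xi> - x)"
  have "H \<xi> p' \<ge> 0"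
  proof -
    let ?\<psi> = "\<lambda>z. (- n) * (norm (z - \<zeta>))\<^sup>2 + (- 1) * (norm (z - x))\<^sup>2"
    have "\<forall>\<^sub>F z in nhds \<xi>. v z - ?\<psi> z \<ge> v \<xi> - ?\<psi> \<xi>"
    proof (rule eventually_mono[OF eventually_nhds_in_open[of "ball x r"]])
      fix z assume "z \<in> ball x r"
      then show "v z - ?\<psi> z \<ge> v \<xi> - ?\<psi> \<xi>"
        using least[OF _ \<zeta>, of z] by simp
    qed (use \<xi>x r in \<open>auto simp: dist_norm norm_minus_commute\<close>)
    then show ?thesis
      using v C1_with_gradient_sum_of_squares[of "- n" \<zeta> "- 1" x]
      unfolding viscosity_supersolution_def p'_def by blast
  qed
  moreover have "H \<xi> p' \<le> b + \<delta> / 3"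
  proof (rule \<rho>(2)[OF _ _ _ Hw])
    have "p - p' = 2 *\<^sub>R (\<xi> - x)" by (simp add: p_def p'_def algebra_simps)
    then have "dist p p' = 2 * norm (\<xi> - x)" by (simp add: dist_norm)
    then show "dist p p' < \<rho>" using \<xi>x r by simp
  qed (use \<rho> \<xi> r in auto)
  ultimately show False using \<delta>(1) by (simp add: b_def field_simps)
qed

section \<open>The intrinsic semidistance and the Aubry set\<close>

text \<open>On a ball containing \<open>x\<close> and \<open>y\<close> all critical subsolutions share the Lipschitz constant
  given by coercivity.\<close>

lemma S0_bdd_above: "bdd_above {u y - u x | u. viscosity_subsolution H 0 u}"
proof -
  define \<rho> where "\<rho> = 2 * (norm x + norm y + 1)"
  obtain K where K: "K > 0" "\<And>\<xi> p. norm \<xi> < \<rho> \<Longrightarrow> H \<xi> p \<le> 0 \<Longrightarrow> norm p \<le> K"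
    using sublevel_bounded[of \<rho> 0] by blast
  have "u y - u x \<le> K * norm (y - x)" if u: "viscosity_subsolution H 0 u" for u
  proof (rule subsolution_increment_le[OF u, of 0 \<rho>])
    fix \<xi> p assume "dist 0 \<xi> < \<rho>" "H \<xi> p \<le> 0"
    then have "norm p * norm (y - x) \<le> K * norm (y - x)"
      using K by (intro mult_right_mono) auto
    then show "p \<bullet> (y - x) \<le> K * norm (y - x)"
      using norm_cauchy_schwarz[of p "y - x"] by linarith
  qed (auto simp: \<rho>_def add_strict_increasing2 add_nonneg_pos)
  then show ?thesis unfolding bdd_above_def by blast
qed

lemma S0_upper:
  assumes "viscosity_subsolution H 0 u"
  shows "u y - u x \<le> S0 H x y"
  unfolding S0_def using assms by (intro cSup_upper S0_bdd_above) auto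

lemma S0_least:
  assumes "viscosity_subsolution H 0 v" "\<And>u. viscosity_subsolution H 0 u \<Longrightarrow> u y - u x \<le> c"
  shows "S0 H x y \<le> c"
  unfolding S0_def using assms by (intro cSup_least) auto

lemma S0_self:
  assumes "viscosity_subsolution H 0 v"
  shows "S0 H x x = 0"
  using S0_upper[OF assms, of x x] S0_least[OF assms, of x x 0] by simp

lemma S0_subsolution:
  assumes v: "viscosity_subsolution H 0 v"
  shows "viscosity_subsolution H 0 (S0 H y)"
proof (rule subsolution_if_frozen_subsolution)
  fix x
  show "frozen_subsolution 0 (S0 H y) x"
    unfolding frozen_subsolution_def
  proof (intro allI impI)
    fix \<eta> :: real assume "\<eta> > 0"
    then obtain r where r: "r > 0"
      "\<And>u. viscosity_subsolution H 0 u \<Longrightarrow> increments_bounded x (0 + \<eta>) u (ball x r)"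
      using subsolution_increments_bounded_uniformly[of \<eta> 0 x] by blast
    have "increments_bounded x (0 + \<eta>) (S0 H y) (ball x r)"
      unfolding increments_bounded_def
    proof (intro ballI allI impI)
      fix z1 z2 s
      assume *: "z1 \<in> ball x r" "z2 \<in> ball x r" "\<forall>p. H x p \<le> 0 + \<eta> \<longrightarrow> p \<bullet> (z2 - z1) \<le> s"
      have "S0 H y z2 \<le> S0 H y z1 + s"
      proof (rule S0_least[OF v])
        fix u assume u: "viscosity_subsolution H 0 u"
        have "u z2 - u z1 \<le> s"
          using r(2)[OF u] * unfolding increments_bounded_def by blast
        then show "u z2 - u y \<le> S0 H y z1 + s" using S0_upper[OF u, of z1 y] by linarith
      qed
      then show "S0 H y z2 - S0 H y z1 \<le> s" by simp
    qed
    then show "\<exists>r>0. increments_bounded x (0 + \<eta>) (S0 H y) (ball x r)" using r(1) by blast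
  qed
qed

lemma not_aubry_if_strict_subsolution:
  assumes u: "viscosity_subsolution H 0 u" "strict_subsolution_at u y"
  shows "y \<notin> aubry_set H"
proof
  assume "y \<in> aubry_set H"
  then have "viscosity_supersolution H 0 (S0 H y)"
    by (simp add: aubry_set_def viscosity_solution_def)
  then show False
  proof (rule supersolution_not_touched_by_strict_subsolution[OF _ u(2)])
    have "S0 H y y - u y \<le> S0 H y z - u z" for z
      using S0_upper[OF u(1), of z y] S0_self[OF u(1), of y] by simp
    then show "\<forall>\<^sub>F z in nhds y. S0 H y y - u y \<le> S0 H y z - u z" by simp
  qed
qed

text \<open>If \<open>w = S0 H y\<close> is not a supersolution, some \<open>\<phi>\<close> with \<open>H x (D\<phi> x) < 0\<close> touches it from
  below at a point \<open>x\<close>. Subtracting \<open>|z - x|\<^sup>2\<close> makes the contact strict, so the raised function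
  \<open>g = \<phi> - |z - x|\<^sup>2 + const\<close> exceeds \<open>w\<close> only in a small ball around \<open>x\<close>, and \<open>u = max w g\<close> is
  a critical subsolution that is strict at \<open>x\<close>. If \<open>x\<close> were not \<open>y\<close>, then \<open>u\<close> would
  vanish at \<open>y\<close> and exceed \<open>S0 H y\<close> at \<open>x\<close>, against the definition of \<open>S0\<close>.\<close>

lemma strict_subsolution_if_not_aubry:
  assumes v: "viscosity_subsolution H 0 v" and y: "y \<notin> aubry_set H"
  obtains u where "viscosity_subsolution H 0 u" "strict_subsolution_at u y"
proof -
  define w where "w = S0 H y"
  have w: "viscosity_subsolution H 0 w" using S0_subsolution[OF v] by (simp add: w_def)
  then have contw: "continuous_on UNIV w" by (simp add: viscosity_subsolution_def)
  have "\<not> viscosity_supersolution H 0 w"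
    using y w by (simp add: aubry_set_def viscosity_solution_def w_def)
  then obtain \<phi> G x where \<phi>: "C1_with_gradient \<phi> G"
    "\<forall>\<^sub>F z in nhds x. w z - \<phi> z \<ge> w x - \<phi> x" "H x (G x) < 0"
    using contw unfolding viscosity_supersolution_def by (auto simp: not_le)
  define \<psi> where "\<psi> z = \<phi> z - (norm (z - x))\<^sup>2" for z
  have C1\<psi>: "C1_with_gradient \<psi> (\<lambda>z. G z - 2 *\<^sub>R (z - x))"
    using C1_with_gradient_diff[OF \<phi>(1) C1_with_gradient_sum_of_squares[of 1 x 0 0]]
    by (simp add: \<psi>_def[abs_def])
  have "frozen_subsolution (H x (G x)) \<psi> x"
    by (rule frozen_subsolution_C1[OF C1\<psi>]) simp
  then have strict\<psi>: "strict_subsolution_at \<psi> x"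
    unfolding strict_subsolution_at_def using \<phi>(3)
    by (intro exI[of _ "- H x (G x)"]) simp
  then obtain e1 where e1: "e1 > 0" "\<And>z. dist z x < e1 \<Longrightarrow> strict_subsolution_at \<psi> z"
    using strict_subsolution_at_open[of \<psi>] unfolding open_dist by blast
  obtain e2 where e2: "e2 > 0" "\<And>z. dist z x < e2 \<Longrightarrow> w z - \<phi> z \<ge> w x - \<phi> x"
    using \<phi>(2) unfolding eventually_nhds_metric by blast
  \<comment> \<open>For \<open>x \<noteq> y\<close> the modification must leave the value at \<open>y\<close> unchanged.\<close>
  define e where "e = min (min e1 e2) (if x = y then 1 else dist x y)"
  have e: "e > 0" "e \<le> e1" "e \<le> e2" "x \<noteq> y \<Longrightarrow> e \<le> dist x y"
    using e1 e2 by (auto simp: e_def)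
  \<comment> \<open>The raise \<open>\<theta>\<close> is used up by \<open>|z - x|\<^sup>2\<close> once \<open>|z - x| \<ge> e / 2\<close>.\<close>
  define \<theta> where "\<theta> = (e / 2)\<^sup>2"
  have \<theta>: "\<theta> > 0" using e by (simp add: \<theta>_def)
  define g where "g z = \<psi> z + (w x - \<psi> x + \<theta>)" for z
  define u where "u z = (if dist z x < e then max (w z) (g z) else w z)" for z
  have frozen_g: "frozen_subsolution 0 g z" if "dist z x < e" for z
  proof -
    have "strict_subsolution_at \<psi> z" using e1(2) that e(2) by simp
    then obtain \<delta> where "\<delta> > 0" "frozen_subsolution (- \<delta>) \<psi> z"
      unfolding strict_subsolution_at_def by blast
    then have "frozen_subsolution 0 \<psi> z" by (auto intro: frozen_subsolution_mono)
    then show ?thesis unfolding g_def[abs_def] by (rule frozen_subsolution_shift)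
  qed
  have g_le: "g z \<le> w z" if "e / 2 \<le> dist z x" "dist z x < e" for z
  proof -
    have "\<theta> \<le> (norm (z - x))\<^sup>2"
      using that e unfolding \<theta>_def by (intro power_mono) (auto simp: dist_norm)
    then show ?thesis using e2(2)[of z] that e by (simp add: g_def \<psi>_def)
  qed
  have u: "viscosity_subsolution H 0 u"
  proof (rule subsolution_if_frozen_subsolution)
    fix z
    have wz: "frozen_subsolution 0 w z" by (rule frozen_subsolution_if_subsolution[OF w])
    show "frozen_subsolution 0 u z"
    proof (cases "dist z x < e")
      case True
      then have "\<forall>\<^sub>F \<zeta> in nhds z. \<zeta> \<in> ball x e"
        by (intro eventually_nhds_in_open) (auto simp: dist_commute)
      then have "\<forall>\<^sub>F \<zeta> in nhds z. max (w \<zeta>) (g \<zeta>) = u \<zeta>"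
        by (rule eventually_mono) (auto simp: u_def dist_commute)
      then show ?thesis
        by (rule frozen_subsolution_local[rotated])
          (intro frozen_subsolution_max wz frozen_g True)
    next
      case False
      then have "\<forall>\<^sub>F \<zeta> in nhds z. \<zeta> \<in> - cball x (e / 2)"
        using e(1) by (intro eventually_nhds_in_open) (auto simp: dist_commute)
      then have "\<forall>\<^sub>F \<zeta> in nhds z. w \<zeta> = u \<zeta>"
      proof (rule eventually_mono)
        fix \<zeta> assume "\<zeta> \<in> - cball x (e / 2)"
        then show "w \<zeta> = u \<zeta>" using g_le[of \<zeta>] by (simp add: u_def dist_commute)
      qed
      then show ?thesis by (rule frozen_subsolution_local[OF wz])
    qed
  qed
  have "x = y"
  proof (rule ccontr)
    assume "x \<noteq> y"
    then have "u y = w y" using e(4) by (simp add: u_def dist_commute)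
    moreover have "u x \<ge> w x + \<theta>" using e(1) by (simp add: u_def g_def)
    moreover have "w y = 0" using S0_self[OF v] by (simp add: w_def)
    moreover have "u x - u y \<le> w x" using S0_upper[OF u] by (simp add: w_def)
    ultimately show False using \<theta> by simp
  qed
  have "strict_subsolution_at u x"
  proof -
    obtain \<delta> where \<delta>: "\<delta> > 0" "frozen_subsolution (- \<delta>) \<psi> x"
      using strict\<psi> unfolding strict_subsolution_at_def by blast
    have "frozen_subsolution (- \<delta>) g x"
      unfolding g_def[abs_def] by (rule frozen_subsolution_shift[OF \<delta>(2)])
    moreover have "\<forall>\<^sub>F z in nhds x. g z = u z"
    proof -
      have "continuous_on UNIV g"
        unfolding g_def[abs_def]
        by (intro continuous_intros C1_with_gradient_continuous_on[OF C1\<psi>])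
      then have "open {z. w z < g z}" using contw by (intro open_Collect_less)
      moreover have "x \<in> {z. w z < g z}" using \<theta> by (simp add: g_def)
      ultimately have "\<forall>\<^sub>F z in nhds x. z \<in> {z. w z < g z}" by (rule eventually_nhds_in_open)
      moreover have "\<forall>\<^sub>F z in nhds x. z \<in> ball x e"
        using e(1) by (intro eventually_nhds_in_open) auto
      ultimately show ?thesis
        by eventually_elim (auto simp: u_def dist_commute)
    qed
    ultimately show ?thesis
      using \<delta>(1) frozen_subsolution_local unfolding strict_subsolution_at_def by blast
  qed
  then show thesis using that u \<open>x = y\<close> by blast
qed

section \<open>Combining global subsolutions\<close>

lemma subsolution_continuous_on:
  assumes "viscosity_subsolution H a u"
  shows "continuous_on S u"
  using assms continuous_on_subset unfolding viscosity_subsolution_def by blast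

lemma subsolution_bounded_on_cball:
  assumes "viscosity_subsolution H a u"
  obtains B where "B > 0" "\<And>y. norm y \<le> S \<Longrightarrow> \<bar>u y\<bar> < B"
proof -
  have "bounded (u ` cball 0 S)"
    by (intro compact_imp_bounded compact_continuous_image subsolution_continuous_on[OF assms] compact_cball)
  then obtain B where "B > 0" "\<And>y. norm y \<le> S \<Longrightarrow> \<bar>u y\<bar> \<le> B"
    unfolding bounded_pos by fastforce
  then show thesis using that[of "B + 1"] by fastforce
qed

lemma subsolution_shift:
  assumes "viscosity_subsolution H a u"
  shows "viscosity_subsolution H a (\<lambda>y. u y + c)"
  by (rule subsolution_if_frozen_subsolution)
    (intro frozen_subsolution_shift frozen_subsolution_if_subsolution assms)

lemma subsolution_min:
  assumes "viscosity_subsolution H a u" "viscosity_subsolution H a w"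
  shows "viscosity_subsolution H a (\<lambda>y. min (u y) (w y))"
  by (rule subsolution_if_frozen_subsolution)
    (intro frozen_subsolution_min frozen_subsolution_if_subsolution assms)

lemma subsolution_convex_combination:
  assumes "viscosity_subsolution H 0 u" "viscosity_subsolution H 0 w" "0 < l" "l < 1"
  shows "viscosity_subsolution H 0 (\<lambda>y. (1 - l) * u y + l * w y)"
proof (rule subsolution_if_frozen_subsolution)
  fix x
  have "frozen_subsolution ((1 - l) * 0 + l * 0) (\<lambda>y. (1 - l) * u y + l * w y) x"
    by (intro frozen_subsolution_convex_combination frozen_subsolution_if_subsolution assms)
  then show "frozen_subsolution 0 (\<lambda>y. (1 - l) * u y + l * w y) x" by simp
qed

lemma strict_subsolution_at_convex_combination:
  assumes u: "viscosity_subsolution H 0 u" and w: "strict_subsolution_at w x"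
    and l: "0 < l" "l < 1"
  shows "strict_subsolution_at (\<lambda>y. (1 - l) * u y + l * w y) x"
proof -
  obtain \<delta> where "\<delta> > 0" "frozen_subsolution (- \<delta>) w x"
    using w unfolding strict_subsolution_at_def by blast
  moreover from this(2) have
    "frozen_subsolution ((1 - l) * 0 + l * (- \<delta>)) (\<lambda>y. (1 - l) * u y + l * w y) x"
    by (intro frozen_subsolution_convex_combination frozen_subsolution_if_subsolution[OF u] l)
  ultimately show ?thesis
    unfolding strict_subsolution_at_def using l by (intro exI[of _ "l * \<delta>"]) simp
qed

lemma strict_subsolution_at_shift:
  assumes "strict_subsolution_at u x"
  shows "strict_subsolution_at (\<lambda>y. u y + c) x"
  using assms frozen_subsolution_shift unfolding strict_subsolution_at_def by blast

section \<open>Behaviour at infinity\<close>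

text \<open>The increments of a critical subsolution near the point \<open>x0\<close> are bounded by the sublevel
  sets at \<open>x0\<close>, which are therefore nonempty for all positive levels; so the maximum over \<open>x\<close> of the
  minimum of \<open>H x\<close> is at most \<open>0\<close>, and the limit superior at infinity is strictly below it.\<close>

lemma negative_near_infinity:
  assumes below: "uniformly_below_max_min_at_infinity H" and v: "viscosity_subsolution H 0 v"
  obtains R \<epsilon> \<delta> where "R > 0" "\<epsilon> > 0" "\<delta> > 0"
    "\<And>x p. norm x > R \<Longrightarrow> norm p < \<epsilon> \<Longrightarrow> H x p \<le> - \<delta>"
proof -
  obtain q x0 \<epsilon> where q: "\<And>x p. H x (q x) \<le> H x p" and \<epsilon>: "\<epsilon> > 0"
    and lim: "Limsup at_infinity (\<lambda>x. SUP p\<in>{p. norm p < \<epsilon>}. ereal (H x p)) < ereal (H x0 (q x0))"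
    using below unfolding uniformly_below_max_min_at_infinity_def by blast
  have "H x0 (q x0) \<le> 0"
  proof (rule field_le_epsilon)
    fix \<eta> :: real assume "\<eta> > 0"
    then obtain r where "r > 0" "increments_bounded x0 (0 + \<eta>) v (ball x0 r)"
      using frozen_subsolution_if_subsolution[OF v] unfolding frozen_subsolution_def by blast
    then obtain p where "H x0 p \<le> 0 + \<eta>"
      using sublevel_nonempty_if_increments_bounded centre_in_ball by metis
    then show "H x0 (q x0) \<le> 0 + \<eta>" using q[of x0 p] by linarith
  qed
  moreover obtain c where c: "Limsup at_infinity (\<lambda>x. SUP p\<in>{p. norm p < \<epsilon>}. ereal (H x p)) < ereal c"
    "ereal c < ereal (H x0 (q x0))"
    using ereal_dense2[OF lim] by blast
  ultimately have "c < 0" by simp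
  obtain b where b: "\<And>x. b \<le> norm x \<Longrightarrow> (SUP p\<in>{p. norm p < \<epsilon>}. ereal (H x p)) < ereal c"
    using Limsup_lessD[OF c(1)] unfolding eventually_at_infinity by blast
  show thesis
  proof (rule that[of "max b 1" \<epsilon> "- c"])
    fix x p :: 'a assume "norm x > max b 1" "norm p < \<epsilon>"
    then have "ereal (H x p) \<le> (SUP p\<in>{p. norm p < \<epsilon>}. ereal (H x p))"
      by (intro SUP_upper) simp
    also have "\<dots> < ereal c" using b \<open>norm x > max b 1\<close> by simp
    finally show "H x p \<le> - (- c)" by simp
  qed (use \<epsilon> \<open>c < 0\<close> in auto)
qed

end

locale hamiltonian_negative_near_infinity = coercive_hamiltonian +
  fixes R \<epsilon> \<delta> :: real
  assumes R_pos: "R > 0" and \<epsilon>_pos: "\<epsilon> > 0" and \<delta>_pos: "\<delta> > 0"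
    and negative: "\<And>x p. norm x > R \<Longrightarrow> norm p < \<epsilon> \<Longrightarrow> H x p \<le> - \<delta>"
begin

text \<open>For \<open>|x| > R\<close> the sublevel set at level \<open>- \<delta>\<close> contains the ball of radius \<open>\<epsilon>\<close>, whose support
  function dominates increments of slope below \<open>\<epsilon>\<close>.\<close>

lemma strict_subsolution_at_if_slow:
  assumes g: "k-lipschitz_on UNIV g" and k: "k < \<epsilon>" and x: "norm x > R"
  shows "strict_subsolution_at g x"
proof -
  have k0: "k \<ge> 0" using g by (rule lipschitz_on_nonneg)
  have "increments_bounded x (- \<delta> + \<eta>) g (ball x 1)" if "\<eta> > 0" for \<eta>
    unfolding increments_bounded_def
  proof (intro ballI allI impI)
    fix y z s
    assume s: "\<forall>p. H x p \<le> - \<delta> + \<eta> \<longrightarrow> p \<bullet> (z - y) \<le> s"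
    define p where "p = (k / norm (z - y)) *\<^sub>R (z - y)"
    have "norm p < \<epsilon>" using k k0 \<epsilon>_pos by (simp add: p_def)
    then have "p \<bullet> (z - y) \<le> s" using negative[OF x] s \<open>\<eta> > 0\<close> by fastforce
    moreover have "p \<bullet> (z - y) = k * norm (z - y)"
      by (simp add: p_def power2_norm_eq_inner[symmetric] power2_eq_square)
    moreover have "g z - g y \<le> k * norm (z - y)"
      using lipschitz_onD[OF g, of z y] by (simp add: dist_real_def dist_norm)
    ultimately show "g z - g y \<le> s" by linarith
  qed
  then show ?thesis
    using \<delta>_pos unfolding strict_subsolution_at_def frozen_subsolution_def
    by (meson zero_less_one)
qed

text \<open>Inside the ball of radius \<open>R\<close> the function \<open>u\<close> wins, outside it both functions are critical
  subsolutions.\<close>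

lemma subsolution_glue:
  assumes u: "viscosity_subsolution H 0 u" and g: "k-lipschitz_on UNIV g" "k < \<epsilon>"
  shows "(\<And>x. norm x \<le> R \<Longrightarrow> g x < u x) \<Longrightarrow> viscosity_subsolution H 0 (\<lambda>x. max (u x) (g x))"
    and "(\<And>x. norm x \<le> R \<Longrightarrow> u x < g x) \<Longrightarrow> viscosity_subsolution H 0 (\<lambda>x. min (u x) (g x))"
proof -
  have fu: "frozen_subsolution 0 u x" for x by (rule frozen_subsolution_if_subsolution[OF u])
  have fg: "frozen_subsolution 0 g x" if "norm x > R" for x
    using strict_subsolution_at_if_slow[OF g that] frozen_subsolution_mono
    unfolding strict_subsolution_at_def by (metis less_imp_le neg_le_0_iff_le)
  have cont: "continuous_on UNIV u" "continuous_on UNIV g"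
    using subsolution_continuous_on[OF u] lipschitz_on_continuous_on[OF g(1)] by auto
  show "viscosity_subsolution H 0 (\<lambda>x. max (u x) (g x))" if less: "\<And>x. norm x \<le> R \<Longrightarrow> g x < u x"
  proof (rule subsolution_if_frozen_subsolution)
    fix x
    show "frozen_subsolution 0 (\<lambda>x. max (u x) (g x)) x"
    proof (cases "norm x > R")
      case False
      have "open {x. g x < u x}" using cont by (intro open_Collect_less)
      then have "\<forall>\<^sub>F y in nhds x. y \<in> {x. g x < u x}"
        using False less by (intro eventually_nhds_in_open) auto
      then have "\<forall>\<^sub>F y in nhds x. u y = max (u y) (g y)" by (rule eventually_mono) simp
      then show ?thesis by (rule frozen_subsolution_local[OF fu])
    qed (intro frozen_subsolution_max fu fg)
  qed
  show "viscosity_subsolution H 0 (\<lambda>x. min (u x) (g x))" if less: "\<And>x. norm x \<le> R \<Longrightarrow> u x < g x"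
  proof (rule subsolution_if_frozen_subsolution)
    fix x
    show "frozen_subsolution 0 (\<lambda>x. min (u x) (g x)) x"
    proof (cases "norm x > R")
      case False
      have "open {x. u x < g x}" using cont by (intro open_Collect_less)
      then have "\<forall>\<^sub>F y in nhds x. y \<in> {x. u x < g x}"
        using False less by (intro eventually_nhds_in_open) auto
      then have "\<forall>\<^sub>F y in nhds x. u y = min (u y) (g y)" by (rule eventually_mono) simp
      then show ?thesis by (rule frozen_subsolution_local[OF fu])
    qed (intro frozen_subsolution_min fu fg)
  qed
qed

text \<open>Bound \<open>v\<close> from above by a constant and let a slowly growing cone take over: far away the
  result is the cone, which is strict there, so there are no Aubry points far away.\<close>

lemma aubry_set_bounded:
  assumes v: "viscosity_subsolution H 0 v"
  obtains S where "\<And>y. y \<in> aubry_set H \<Longrightarrow> norm y \<le> S"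
proof -
  obtain B where B: "B > 0" "\<And>y. norm y \<le> R \<Longrightarrow> \<bar>v y\<bar> < B"
    using subsolution_bounded_on_cball[OF v] by blast
  define k where "k = \<epsilon> / 2"
  have k: "k > 0" "k < \<epsilon>" using \<epsilon>_pos by (auto simp: k_def)
  define g :: "'a \<Rightarrow> real" where "g x = (- B - k * R) + k * norm x" for x
  have g: "k-lipschitz_on UNIV g"
    using lipschitz_on_cone[of k "- B - k * R"] k by (simp add: g_def[abs_def])
  define u where "u x = max (min (v x) B) (g x)" for x
  have "viscosity_subsolution H 0 (\<lambda>x. min (v x) B)"
    by (rule subsolution_glue(2)[OF v]) (use B(2) \<epsilon>_pos in \<open>auto simp: abs_less_iff intro: lipschitz_on_constant\<close>)
  then have u: "viscosity_subsolution H 0 u"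
    unfolding u_def[abs_def]
  proof (rule subsolution_glue(1)[OF _ g k(2)])
    fix x :: 'a assume x: "norm x \<le> R"
    then have "k * norm x \<le> k * R" using k by simp
    then show "g x < min (v x) B" using B(1) B(2)[OF x] by (simp add: g_def abs_less_iff)
  qed
  show thesis
  proof (rule that[of "R + 2 * B / k"], rule ccontr)
    fix y assume y: "y \<in> aubry_set H" and "\<not> norm y \<le> R + 2 * B / k"
    then have far: "norm y > R + 2 * B / k" by simp
    then have "k * norm y > k * (R + 2 * B / k)" using k by simp
    then have "g y > B" using k by (simp add: g_def distrib_left)
    have "open {x. B < g x}"
      by (intro open_Collect_less continuous_on_const lipschitz_on_continuous_on[OF g])
    then have "\<forall>\<^sub>F x in nhds y. x \<in> {x. B < g x}"
      using \<open>g y > B\<close> by (intro eventually_nhds_in_open) auto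
    then have "\<forall>\<^sub>F x in nhds y. g x = u x"
      by (rule eventually_mono) (auto simp: u_def)
    moreover have "strict_subsolution_at g y"
    proof (rule strict_subsolution_at_if_slow[OF g k(2)])
      have "2 * B / k > 0" using B k by simp
      then show "norm y > R" using far by linarith
    qed
    ultimately have "strict_subsolution_at u y"
      using frozen_subsolution_local unfolding strict_subsolution_at_def by blast
    then show False using not_aubry_if_strict_subsolution[OF u] y by blast
  qed
qed

section \<open>Weak KAM solutions and lower bounds\<close>

lemma bdd_below_if_weak_KAM:
  assumes "weak_KAM_solution H v"
  shows "bdd_below (range v)"
proof -
  have v: "viscosity_subsolution H 0 v"
    and rep: "\<And>x. \<exists>y\<in>aubry_set H. v x = v y + S0 H y x"
    using assms by (auto simp: weak_KAM_solution_def viscosity_solution_def)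
  obtain B where B: "B > 0" "\<And>y. norm y \<le> R \<Longrightarrow> \<bar>v y\<bar> < B"
    using subsolution_bounded_on_cball[OF v] by blast
  \<comment> \<open>A critical subsolution that is bounded below.\<close>
  have u: "viscosity_subsolution H 0 (\<lambda>x. max (v x) (- B))"
    by (rule subsolution_glue(1)[OF v])
      (use B(2) \<epsilon>_pos in \<open>auto simp: abs_less_iff minus_less_iff intro: lipschitz_on_constant\<close>)
  obtain S where S: "\<And>y. y \<in> aubry_set H \<Longrightarrow> norm y \<le> S"
    using aubry_set_bounded[OF v] by blast
  obtain C where C: "C > 0" "\<And>y. norm y \<le> S \<Longrightarrow> \<bar>v y\<bar> < C"
    using subsolution_bounded_on_cball[OF v] by blast
  obtain D where D: "D > 0" "\<And>y. norm y \<le> S \<Longrightarrow> \<bar>max (v y) (- B)\<bar> < D"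
    using subsolution_bounded_on_cball[OF u] by blast
  have "v x \<ge> - C - B - D" for x
  proof -
    obtain y where y: "y \<in> aubry_set H" "v x = v y + S0 H y x" using rep by blast
    have "max (v x) (- B) - max (v y) (- B) \<le> S0 H y x" by (rule S0_upper[OF u])
    then show ?thesis
      using y(2) C(2)[OF S[OF y(1)]] D(2)[OF S[OF y(1)]] by linarith
  qed
  then show ?thesis by (intro bdd_belowI[of _ "- C - B - D"]) auto
qed

text \<open>Otherwise \<open>v\<close> would be touched from below, at a point of a large ball, by a combination of
  critical subsolutions that is strict there. The set function \<open>Q\<close> collects what the combination needs
  on a set \<open>N\<close>: critical subsolutions \<open>w\<close> and \<open>u\<close>, the first agreeing with \<open>v\<close> at \<open>x0\<close>, such that each
  point of \<open>N\<close> is excluded as a point of contact by \<open>w\<close> or made strict by \<open>u\<close>. It holds near each point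
  and is preserved by unions, hence holds on the compact ball.\<close>

lemma aubry_minimizer_exists:
  assumes v: "viscosity_solution H 0 v" and bdd: "bdd_below (range v)"
  shows "\<exists>y\<in>aubry_set H. v x0 = v y + S0 H y x0"
proof (rule ccontr)
  assume none: "\<not> ?thesis"
  have sub: "viscosity_subsolution H 0 v" and super: "viscosity_supersolution H 0 v"
    using v by (auto simp: viscosity_solution_def)
  define k where "k = \<epsilon> / 2"
  have k: "k > 0" "\<bar>- k\<bar> < \<epsilon>" using \<epsilon>_pos by (auto simp: k_def)
  obtain L where L: "\<And>x. L \<le> v x" using bdd unfolding bdd_below_def by auto
  define R' where "R' = max R (norm x0)"
  obtain B where B: "B > 0" "\<And>y. norm y \<le> R' \<Longrightarrow> \<bar>v y\<bar> < B"
    using subsolution_bounded_on_cball[OF sub] by blast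
  define M where "M = B + k * R'"
  define g :: "'a \<Rightarrow> real" where "g x = M + (- k) * norm x" for x
  have g: "\<bar>- k\<bar>-lipschitz_on UNIV g"
    using lipschitz_on_cone[of "- k" M] by (simp only: g_def[abs_def])
  have v_less_g: "v x < g x" if "norm x \<le> R'" for x
  proof -
    have "k * norm x \<le> k * R'" using that k by simp
    then show ?thesis using B(2)[OF that] by (simp add: g_def M_def abs_less_iff)
  qed
  \<comment> \<open>The cone \<open>g\<close> decreases without bound and \<open>v\<close> does not; so \<open>w0 < v\<close> on a large sphere, although
      \<open>w0 = v\<close> at \<open>x0\<close>.\<close>
  define w0 where "w0 x = min (v x) (g x)" for x
  have w0: "viscosity_subsolution H 0 w0"
    unfolding w0_def[abs_def]
    by (rule subsolution_glue(2)[OF sub g k(2)]) (auto intro: v_less_g simp: R'_def)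
  have w0x0: "w0 x0 = v x0" using v_less_g[of x0] by (simp add: w0_def R'_def)
  define K where "K = max (norm x0) ((M - L) / k + 1)"
  have w0_sphere: "w0 y < v y" if "norm y = K" for y
  proof -
    have "(M - L) / k + 1 \<le> norm y" using that by (simp add: K_def)
    then have "k * ((M - L) / k + 1) \<le> k * norm y" using k by simp
    then have "g y < L" using k by (simp add: g_def distrib_left)
    then show ?thesis using L[of y] by (simp add: w0_def)
  qed
  define Q where "Q N \<longleftrightarrow> (\<exists>w u. viscosity_subsolution H 0 w \<and> w x0 = v x0 \<and> (\<forall>y. w y \<le> w0 y) \<and>
      viscosity_subsolution H 0 u \<and> (\<forall>y\<in>N. w y < v y \<or> strict_subsolution_at u y))" for N
  have Q_I: "Q N"
    if "viscosity_subsolution H 0 w" "w x0 = v x0" "\<And>y. w y \<le> w0 y" "viscosity_subsolution H 0 u"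
      "\<And>y. y \<in> N \<Longrightarrow> w y < v y \<or> strict_subsolution_at u y" for N w u
    unfolding Q_def using that by blast
  have Q_nbhd: "\<exists>N. open N \<and> y \<in> N \<and> Q N" for y
  proof (cases "y \<in> aubry_set H")
    case True
    then have "v x0 \<noteq> v y + S0 H y x0" using none by blast
    moreover have "v x0 - v y \<le> S0 H y x0" by (rule S0_upper[OF sub])
    ultimately have less: "v x0 - v y < S0 H y x0" by linarith
    \<comment> \<open>As \<open>S0 H y x0\<close> is a supremum, one subsolution already exceeds \<open>v x0 - v y\<close>; shifted to agree
        with \<open>v\<close> at \<open>x0\<close>, it is below \<open>v\<close> at \<open>y\<close>.\<close>
    obtain u where u: "viscosity_subsolution H 0 u" "u x0 - u y > v x0 - v y"
    proof (rule ccontr)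
      assume "\<not> thesis"
      then have "u x0 - u y \<le> v x0 - v y" if "viscosity_subsolution H 0 u" for u
        using \<open>\<And>u. viscosity_subsolution H 0 u \<Longrightarrow> v x0 - v y < u x0 - u y \<Longrightarrow> thesis\<close> that by force
      then have "S0 H y x0 \<le> v x0 - v y" by (rule S0_least[OF sub])
      with less show False by simp
    qed
    define w where "w x = min (u x + (v x0 - u x0)) (w0 x)" for x
    have w: "viscosity_subsolution H 0 w"
      unfolding w_def[abs_def] by (intro subsolution_min subsolution_shift u w0)
    have "open {x. w x < v x}"
      by (intro open_Collect_less subsolution_continuous_on[OF w] subsolution_continuous_on[OF sub])
    moreover have "y \<in> {x. w x < v x}" using u(2) by (simp add: w_def min_less_iff_disj)
    moreover have "Q {x. w x < v x}"
      by (rule Q_I[of w v]) (use w w0x0 sub in \<open>auto simp: w_def\<close>)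
    ultimately show ?thesis by blast
  next
    case False
    then obtain u where u: "viscosity_subsolution H 0 u" "strict_subsolution_at u y"
      using strict_subsolution_if_not_aubry[OF sub] by blast
    have "Q {x. strict_subsolution_at u x}"
      by (rule Q_I[of w0 u]) (use w0 w0x0 u in auto)
    then show ?thesis using u(2) strict_subsolution_at_open[of u] by blast
  qed
  have Q_Un: "Q (N1 \<union> N2)" if "Q N1" "Q N2" for N1 N2
  proof -
    obtain w1 u1 where 1: "viscosity_subsolution H 0 w1" "w1 x0 = v x0" "\<And>y. w1 y \<le> w0 y"
      "viscosity_subsolution H 0 u1" "\<And>y. y \<in> N1 \<Longrightarrow> w1 y < v y \<or> strict_subsolution_at u1 y"
      using \<open>Q N1\<close> unfolding Q_def by blast
    obtain w2 u2 where 2: "viscosity_subsolution H 0 w2" "w2 x0 = v x0" "\<And>y. w2 y \<le> w0 y"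
      "viscosity_subsolution H 0 u2" "\<And>y. y \<in> N2 \<Longrightarrow> w2 y < v y \<or> strict_subsolution_at u2 y"
      using \<open>Q N2\<close> unfolding Q_def by blast
    define u where "u y = (1 - 1/2) * u1 y + (1/2) * u2 y" for y
    have u': "u y = (1 - 1/2) * u2 y + (1/2) * u1 y" for y by (simp add: u_def)
    have "viscosity_subsolution H 0 u"
      unfolding u_def[abs_def] by (intro subsolution_convex_combination 1 2) auto
    moreover have "strict_subsolution_at u y"
      if "strict_subsolution_at u1 y \<or> strict_subsolution_at u2 y" for y
      using that
    proof
      assume "strict_subsolution_at u1 y"
      then show ?thesis unfolding u'[abs_def] by (intro strict_subsolution_at_convex_combination 2) auto
    next
      assume "strict_subsolution_at u2 y"
      then show ?thesis unfolding u_def[abs_def] by (intro strict_subsolution_at_convex_combination 1) auto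
    qed
    moreover have "viscosity_subsolution H 0 (\<lambda>y. min (w1 y) (w2 y))" by (intro subsolution_min 1 2)
    ultimately show ?thesis
      by (intro Q_I[of "\<lambda>y. min (w1 y) (w2 y)" u])
        (use 1(2,3,5) 2(2,5) in \<open>auto simp: min_less_iff_disj min_le_iff_disj\<close>)
  qed
  have "Q (cball 0 K)"
  proof -
    obtain N where N: "\<And>y. open (N y)" "\<And>y. y \<in> N y" "\<And>y. Q (N y)" using Q_nbhd by metis
    obtain D where D: "finite D" "cball 0 K \<subseteq> (\<Union>y\<in>D. N y)"
      by (rule compactE_image[OF compact_cball[of 0 K], of "cball 0 K" N]) (use N in auto)
    have "Q (\<Union>y\<in>D. N y)"
      using D(1)
    proof induction
      case empty
      then show ?case
        by (intro Q_I[of w0 v]) (use w0 w0x0 sub in auto)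
    next
      case (insert y D)
      then show ?case using Q_Un N(3) by simp
    qed
    then show ?thesis using D(2) unfolding Q_def by blast
  qed
  then obtain w u where w: "viscosity_subsolution H 0 w" "w x0 = v x0" "\<And>y. w y \<le> w0 y"
    and u: "viscosity_subsolution H 0 u"
    and alt: "\<And>y. norm y \<le> K \<Longrightarrow> w y < v y \<or> strict_subsolution_at u y"
    unfolding Q_def by auto
  define u' where "u' y = u y + (v x0 - u x0)" for y
  have u': "viscosity_subsolution H 0 u'" unfolding u'_def[abs_def] by (rule subsolution_shift[OF u])
  \<comment> \<open>On \<open>E\<close>, where the combination may fail to be strict or the minimum may be on the boundary,
      \<open>w < v\<close> with a uniform gap \<open>\<mu>\<close>; the weight \<open>l\<close> of \<open>u'\<close> is too small to close it.\<close>
  define E where "E = cball 0 K \<inter> (- {y. strict_subsolution_at u y} \<union> sphere 0 K)"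
  have "compact E"
    unfolding E_def using strict_subsolution_at_open[of u]
    by (intro compact_Int_closed compact_cball closed_Un) auto
  have gapE: "v y - w y > 0" if "y \<in> E" for y
  proof (cases "norm y = K")
    case True
    then show ?thesis using w0_sphere w(3)[of y] by force
  next
    case False
    then show ?thesis using that alt[of y] by (auto simp: E_def)
  qed
  obtain \<mu> where \<mu>: "\<mu> > 0" "\<And>y. y \<in> E \<Longrightarrow> v y - w y \<ge> \<mu>"
  proof (cases "E = {}")
    case False
    have "continuous_on E (\<lambda>y. v y - w y)"
      by (intro continuous_intros subsolution_continuous_on[OF sub] subsolution_continuous_on[OF w(1)])
    then obtain y where "y \<in> E" "\<And>z. z \<in> E \<Longrightarrow> v y - w y \<le> v z - w z"
      using continuous_attains_inf[OF \<open>compact E\<close> False] by blast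
    then show thesis using that[of "v y - w y"] gapE by blast
  qed (use that[of 1] in simp)
  obtain C where C: "C > 0" "\<And>y. norm y \<le> K \<Longrightarrow> \<bar>u' y\<bar> < C"
    using subsolution_bounded_on_cball[OF u'] by blast
  obtain D where D: "D > 0" "\<And>y. norm y \<le> K \<Longrightarrow> \<bar>w y\<bar> < D"
    using subsolution_bounded_on_cball[OF w(1)] by blast
  define l where "l = min (1/2) (\<mu> / (C + D))"
  have l: "0 < l" "l < 1" using \<mu>(1) C(1) D(1) by (auto simp: l_def)
  have "l * (C + D) \<le> \<mu> / (C + D) * (C + D)"
    using C(1) D(1) by (intro mult_right_mono) (auto simp: l_def)
  then have l\<mu>: "l * (C + D) \<le> \<mu>" using C(1) D(1) by simp
  define W where "W y = (1 - l) * w y + l * u' y" for y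
  have "viscosity_subsolution H 0 W"
    unfolding W_def[abs_def] by (rule subsolution_convex_combination[OF w(1) u' l])
  then have "continuous_on (cball 0 K) (\<lambda>y. v y - W y)"
    by (intro continuous_intros subsolution_continuous_on[OF sub] subsolution_continuous_on)
  moreover have x0K: "x0 \<in> cball 0 K" by (simp add: K_def)
  ultimately obtain y where y: "y \<in> cball 0 K" "\<And>z. z \<in> cball 0 K \<Longrightarrow> v y - W y \<le> v z - W z"
    using continuous_attains_inf[OF compact_cball, of 0 K "\<lambda>y. v y - W y"] by blast
  have "W x0 = v x0" using w(2) by (simp add: W_def u'_def algebra_simps)
  then have neg: "v y \<le> W y" using y(2)[OF x0K] by simp
  have "y \<notin> E"
  proof
    assume "y \<in> E"
    have "W y - w y = l * (u' y - w y)" by (simp add: W_def algebra_simps)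
    also have "\<dots> < l * (C + D)"
      using C(2)[of y] D(2)[of y] y(1) l(1) by (intro mult_strict_left_mono) (auto simp: abs_less_iff)
    finally show False using \<mu>(2)[OF \<open>y \<in> E\<close>] l\<mu> neg by linarith
  qed
  then have y': "norm y < K" "strict_subsolution_at u y" using y(1) by (auto simp: E_def)
  have "strict_subsolution_at W y"
    unfolding W_def[abs_def] u'_def
    by (intro strict_subsolution_at_convex_combination strict_subsolution_at_shift w y' l)
  then show False
  proof (rule supersolution_not_touched_by_strict_subsolution[OF super])
    have "\<forall>\<^sub>F z in nhds y. z \<in> ball 0 K" using y'(1) by (intro eventually_nhds_in_open) auto
    then show "\<forall>\<^sub>F z in nhds y. v y - W y \<le> v z - W z"
      by (rule eventually_mono) (use y(2) in auto)
  qed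
qed

lemma weak_KAM_iff_bdd_below:
  assumes v: "viscosity_solution H 0 v"
  shows "weak_KAM_solution H v \<longleftrightarrow> bdd_below (range v)"
proof
  assume bdd: "bdd_below (range v)"
  have "v x - v y \<le> S0 H y x" for x y
    using v by (intro S0_upper) (simp add: viscosity_solution_def)
  then have "v x \<le> v y + S0 H y x" for x y by (simp add: algebra_simps)
  then show "weak_KAM_solution H v"
    using v aubry_minimizer_exists[OF v bdd] by (simp add: weak_KAM_solution_def)
qed (rule bdd_below_if_weak_KAM)

end

text \<open>The limit hypothesis gives, for a bounded set of \<open>x\<close>, a radius beyond which \<open>H\<close>
  exceeds any given level.\<close>

lemma coercive_hamiltonianI:
  fixes H :: "'a::euclidean_space \<Rightarrow> 'a \<Rightarrow> real"
  assumes "continuous_on UNIV (\<lambda>(x, p). H x p)" "\<And>x. convex_on UNIV (H x)"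
    and lim: "\<And>R. R > 0 \<Longrightarrow>
      ((\<lambda>r. INF (x, p)\<in>{(x, p). norm x < R \<and> norm p \<ge> r}. ereal (H x p)) \<longlongrightarrow> \<infinity>) at_top"
  shows "coercive_hamiltonian H"
proof
  fix R a :: real
  have "\<forall>\<^sub>F r in at_top. ereal a < (INF (x, p)\<in>{(x, p). norm x < max R 1 \<and> norm p \<ge> r}. ereal (H x p))"
    using lim[of "max R 1"] unfolding tendsto_PInfty by simp
  then obtain r where r: "ereal a < (INF (x, p)\<in>{(x, p). norm x < max R 1 \<and> norm p \<ge> r}. ereal (H x p))"
    unfolding eventually_at_top_linorder by blast
  have "norm p \<le> r" if "norm x < R" "H x p \<le> a" for x p
  proof (rule ccontr)
    assume "\<not> norm p \<le> r"
    then have "(INF (x, p)\<in>{(x, p). norm x < max R 1 \<and> norm p \<ge> r}. ereal (H x p)) \<le> ereal (H x p)"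
      using that(1) by (intro INF_lower2[of "(x, p)"]) auto
    with r have "ereal a < ereal (H x p)" by (rule less_le_trans)
    with that(2) show False by simp
  qed
  then show "\<exists>K. \<forall>x p. norm x < R \<longrightarrow> H x p \<le> a \<longrightarrow> norm p \<le> K" by blast
qed (use assms in auto)

section \<open>The characterization of weak KAM solutions\<close>

theorem theorem4p7:
  fixes H :: "real ^ 'n \<Rightarrow> real ^ 'n \<Rightarrow> real"
    and v :: "real ^ 'n \<Rightarrow> real"
  assumes A1: "continuous_on UNIV (\<lambda>(x, p). H x p)"
    and A2_convex: "\<And>x. convex_on UNIV (H x)"
    and A2_coercive: "\<And>R. R > 0 \<Longrightarrow>
      ((\<lambda>r. INF (x, p)\<in>{(x, p). norm x < R \<and> norm p \<ge> r}. ereal (H x p)) \<longlongrightarrow> \<infinity>) at_top"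
    and A3: "uniformly_below_max_min_at_infinity H"
    and critical: "critical_value H = 0"
    and sol: "viscosity_solution H 0 v"
  shows "weak_KAM_solution H v \<longleftrightarrow> bdd_below (range v)"
proof -
  interpret coercive_hamiltonian H
    by (rule coercive_hamiltonianI[OF A1 A2_convex A2_coercive])
  have "viscosity_subsolution H 0 v" using sol by (simp add: viscosity_solution_def)
  then obtain R \<epsilon> \<delta> where "R > 0" "\<epsilon> > 0" "\<delta> > 0"
    "\<And>x p. norm x > R \<Longrightarrow> norm p < \<epsilon> \<Longrightarrow> H x p \<le> - \<delta>"
    using negative_near_infinity[OF A3] by blast
  then interpret hamiltonian_negative_near_infinity H R \<epsilon> \<delta>
    by unfold_locales
  show ?thesis by (rule weak_KAM_iff_bdd_below[OF sol])
qed

end
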